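(* Let $k\ge 1$ and $K=\mathbb{Q}(u)$. For each $j\in\{1,\dots,k\}$ the matrices defining $\check X^{(j)}\big(([2]^j a^{(j)})^2\big)$ define a $K\check{\mathscr H}^{(j)}_3$-module $\check M^{(j)}:=\check X^{(j)}\big(([2]^j a^{(j)})^2\big)$, and a complete list of pairwise non-isomorphic irreducible representations of $K\check{\mathscr H}^{(k)}_3$ consists of the trivial and sign representations $\check\epsilon_+,\ \check\epsilon_-$ and the $k$ two-dimensional representations $$\epsilon_+^{\otimes k-1}\otimes\check M^{(1)},\quad \epsilon_+^{\otimes k-2}\otimes\check M^{(2)},\quad \dots,\quad \check M^{(k)} .$$
   Context: Let $\mathbf A=\mathbb Z[u,u^{-1}]$, $[2]=u+u^{-1}$. Let $\mathscr H_3$ be the Hecke algebra of the symmetric group $\mathcal S_3$ with simple reflections $S=\{s_1,s_2\}$: the $\mathbf A$-algebra with free $\mathbf A$-basis $\{T_w:w\in\mathcal S_3\}$ and relations $T_vT_w=T_{vw}$ if $\ell(vw)=\ell(v)+\ell(w)$, $(T_s-u)(T_s+u^{-1})=0$ for $s\in S$. Put $C'_s=T_s+u^{-1}$ and $C_s=T_s-u$. For $k\ge1$, $\check{\mathscr H}^{(k)}_3$ is the unital $\mathbf A$-subalgebra of $\mathscr H_3^{\otimes k}$ (tensor product over $\mathbf A$) generated by the elements $\mathcal P^{(k)}_i:=\mathcal P^{(k)}_{s_i}$, $i=1,2$, where $$\mathcal P^{(k)}_s=\sum_{\mathbf a\in\{+,-\}^k,\ |\{i:a_i=-\}|\text{ even}}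 c_{a_1}\otimes\cdots\otimes c_{a_k},\qquad c_+=C'_s,\ c_-=C_s .$$ (So $\check{\mathscr H}^{(1)}_3=\mathscr H_3$ and $\mathcal P^{(1)}_s=C'_s$.) Write $K\check{\mathscr H}^{(k)}_3=K\otimes_{\mathbf A}\check{\mathscr H}^{(k)}_3$. Trivial and sign representations of $\check{\mathscr H}^{(k)}_3$ (one-dimensional): $\check\epsilon_+:\mathcal P^{(k)}_s\mapsto[2]^k$, $\check\epsilon_-:\mathcal P^{(k)}_s\mapsto0$ for $s\in S$. The trivial representation $\epsilon_+$ of $\mathscr H_3$ is $C'_s\mapsto[2]$. For $c\in K$, $\check X^{(k)}(c)$ denotes $K^2$ (column vectors) with the action $$\mathcal P^{(k)}_1\mapsto\begin{pmatrix}[2]^k&c\\0&0\end{pmatrix},\qquad \mathcal P^{(k)}_2\mapsto\begin{pmatrix}0&0\\1&[2]^k\end{pmatrix},$$ whenever this defines a module. $T_k(x)$ is the Chebyshev polynomial of the first kind, $T_k(\cos\theta)=\cos(k\theta)$, and $a^{(k)}=T_k\big(\tfrac1{[2]}\big)$. For $k=k_l+k_r$ with $k_l,k_r\geq 1$, one has $\check{\mathscr H}^{(k)}_3\subseteq\check{\mathscr H}^{(k_l)}_3\otimes\check{\mathscr H}^{(k_r)}_3$ inside $\mathscr H_3^{\otimes k}$, with $\mathcal P^{(k)}_s=\mathcal P^{(k_l)}_s\otimes\mathcal P^{(k_r)}_s+([2]^{k_l}-\mathcal P^{(k_l)}_s)\otimes([2]^{k_r}-\mathcal P^{(k_r)}_s)$;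 tensor products of modules are regarded as $\check{\mathscr H}^{(k)}_3$-modules by restriction. In particular $\mathcal P^{(k)}_s$ acts on $\epsilon_+^{\otimes k-j}\otimes\check M^{(j)}$ as $[2]^{k-j}\mathcal P^{(j)}_s$ acts on $\check M^{(j)}$. Base changes to $K$ are denoted by the same symbols. *)

theory Defs
  imports
    "HOL-Analysis.Analysis"
    "HOL-Combinatorics.Permutations"
    "HOL-Computational_Algebra.Polynomial"
    "HOL-Computational_Algebra.Fraction_Field"
    "HOL-Library.Function_Algebras"
begin

section \<open>The ground rings\<close>

type_synonym K = "rat poly fract"

definition u :: K where
  "u = Fract [:0, 1:] 1"

definition laurent :: "K set" where
  "laurent = {poly (map_poly of_int p) u / u ^ n | (p :: int poly) (n :: nat). True}"

definition two :: K where
  "two = u + inverse u"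

fun chebyshev_T :: "nat \<Rightarrow> 'a::comm_ring_1 poly" where
  "chebyshev_T 0 = 1"
| "chebyshev_T (Suc 0) = [:0, 1:]"
| "chebyshev_T (Suc (Suc n)) = [:0, 2:] * chebyshev_T (Suc n) - chebyshev_T n"

lemma chebyshev_T_cos: "poly (chebyshev_T n) (cos (x :: real)) = cos (real n * x)"
proof (induction n rule: chebyshev_T.induct)
  case (3 n)
  have "cos (real (Suc (Suc n)) * x) + cos (real n * x) = 2 * cos x * cos (real (Suc n) * x)"
    using cos_add[of "real (Suc n) * x" x] cos_diff[of "real (Suc n) * x" x]
    by (simp add: algebra_simps)
  with 3 show ?case by (simp add: algebra_simps)
qed simp_all

definition a_cheb :: "nat \<Rightarrow> K" where
  "a_cheb k = poly (chebyshev_T k) (1 / two)"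


section \<open>The symmetric group on three letters\<close>

type_synonym perm3 = "nat \<Rightarrow> nat"

definition S3 :: "perm3 set" where
  "S3 = {p. p permutes {1, 2, 3}}"

definition simple :: "nat \<Rightarrow> perm3" where
  "simple i = Transposition.transpose i (i + 1)"

definition word_prod :: "nat list \<Rightarrow> perm3" where
  "word_prod is = foldr (\<lambda>i p. simple i \<circ> p) is id"

definition len :: "perm3 \<Rightarrow> nat" where
  "len w = (LEAST n. \<exists>is. set is \<subseteq> {1, 2} \<and> length is = n \<and> word_prod is = w)"

definition reduced_word :: "perm3 \<Rightarrow> nat list" where
  "reduced_word w = (SOME is. set is \<subseteq> {1, 2} \<and> word_prod is = w \<and> length is = len w)"


section \<open>The Hecke algebra\<close>

type_synonym hecke = "perm3 \<Rightarrow> K"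

text \<open>An element of \<open>K \<otimes> H\<^sub>3\<close> is the family of its coefficients in the basis \<open>T\<^sub>w\<close>, extended by
  zero outside \<^const>\<open>S3\<close>; it lies in \<open>H\<^sub>3\<close> itself iff all coefficients are in \<^const>\<open>laurent\<close>.\<close>

definition T :: "perm3 \<Rightarrow> hecke" where
  "T w = (\<lambda>x. if x = w then 1 else 0)"

text \<open>Left multiplication by \<open>T\<^sub>s\<close>, \<open>s = s\<^sub>i\<close>: one has \<open>T\<^sub>s T\<^sub>w = T\<^sub>s\<^sub>w\<close> if \<open>len (s w) > len w\<close>, and
  otherwise \<open>T\<^sub>s T\<^sub>w = T\<^sub>s\<^sup>2 T\<^sub>s\<^sub>w = T\<^sub>s\<^sub>w + (u - inverse u) T\<^sub>w\<close>; below, the coefficient of \<open>T\<^sub>w\<close> is collected.\<close>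

definition lmul :: "nat \<Rightarrow> hecke \<Rightarrow> hecke" where
  "lmul i h = (\<lambda>w. if w \<in> S3 then h (simple i \<circ> w)
     + (if len (simple i \<circ> w) < len w then (u - inverse u) * h w else 0) else 0)"

definition hmult :: "hecke \<Rightarrow> hecke \<Rightarrow> hecke" where
  "hmult g h = (\<lambda>x. \<Sum>v\<in>S3. g v * foldr lmul (reduced_word v) h x)"

definition C_plus :: "nat \<Rightarrow> hecke" where
  "C_plus i = (\<lambda>x. T (simple i) x + inverse u * T id x)"

definition C_minus :: "nat \<Rightarrow> hecke" where
  "C_minus i = (\<lambda>x. T (simple i) x - u * T id x)"

definition eps_T :: "perm3 \<Rightarrow> K" where
  "eps_T w = u ^ len w"

definition eps :: "hecke \<Rightarrow> K" where
  "eps h = (\<Sum>w\<in>S3. h w * eps_T w)"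


subsection \<open>The defining relations\<close>

abbreviation (input) "s1 \<equiv> simple 1"
abbreviation (input) "s2 \<equiv> simple 2"
abbreviation (input) "w12 \<equiv> simple 1 \<circ> simple 2"
abbreviation (input) "w21 \<equiv> simple 2 \<circ> simple 1"
abbreviation (input) "w0 \<equiv> simple 1 \<circ> simple 2 \<circ> simple 1"

lemma simple_apply:
  "simple 1 x = (if x = 1 then 2 else if x = 2 then 1 else x)"
  "simple (Suc 0) x = (if x = 1 then 2 else if x = 2 then 1 else x)"
  "simple 2 x = (if x = 2 then 3 else if x = 3 then 2 else x)"
  by (auto simp: simple_def Transposition.transpose_def)

lemma S3_eq: "S3 = {id, s1, s2, w12, w21, w0}"
proof
  have "simple 1 permutes {1, 2, 3}" "simple 2 permutes {1, 2, 3}"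
    by (auto simp: simple_def intro!: permutes_swap_id)
  then show "{id, s1, s2, w12, w21, w0} \<subseteq> S3"
    by (auto simp: S3_def intro!: permutes_compose permutes_id)
next
  show "S3 \<subseteq> {id, s1, s2, w12, w21, w0}"
  proof
    fix p assume "p \<in> S3"
    then have p: "p permutes {1, 2, 3}" by (simp add: S3_def)
    have out: "p x = x" if "x \<noteq> 1" "x \<noteq> 2" "x \<noteq> 3" for x
      using p that by (simp add: permutes_def)
    have "p 1 \<in> {1,2,3}" "p 2 \<in> {1,2,3}" "p 3 \<in> {1,2,3}"
      by (simp_all only: permutes_in_image[OF p]) simp_all
    moreover have "p 1 \<noteq> p 2" "p 1 \<noteq> p 3" "p 2 \<noteq> p 3"
      using inj_eq[OF permutes_inj[OF p]] by simp_all
    note vals = calculation this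
    have ext: "p = q" if "p 1 = q 1" "p 2 = q 2" "p 3 = q 3"
        "\<And>x. x \<noteq> 1 \<Longrightarrow> x \<noteq> 2 \<Longrightarrow> x \<noteq> 3 \<Longrightarrow> q x = x" for q
    proof
      fix x show "p x = q x"
        using that out[of x] by (cases "x = 1 \<or> x = 2 \<or> x = 3") auto
    qed
    from vals consider
      "p 1 = 1" "p 2 = 2" "p 3 = 3" | "p 1 = 2" "p 2 = 1" "p 3 = 3" |
      "p 1 = 1" "p 2 = 3" "p 3 = 2" | "p 1 = 2" "p 2 = 3" "p 3 = 1" |
      "p 1 = 3" "p 2 = 1" "p 3 = 2" | "p 1 = 3" "p 2 = 2" "p 3 = 1"
      by (simp only: insert_iff empty_iff) presburger
    then show "p \<in> {id, s1, s2, w12, w21, w0}"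
    proof cases
      case 1 then have "p = id" by (intro ext) auto then show ?thesis by simp
    next
      case 2 then have "p = s1" by (intro ext) (auto simp: simple_apply) then show ?thesis by simp
    next
      case 3 then have "p = s2" by (intro ext) (auto simp: simple_apply) then show ?thesis by simp
    next
      case 4 then have "p = w12" by (intro ext) (auto simp: simple_apply) then show ?thesis by simp
    next
      case 5 then have "p = w21" by (intro ext) (auto simp: simple_apply) then show ?thesis by simp
    next
      case 6 then have "p = w0" by (intro ext) (auto simp: simple_apply) then show ?thesis by simp
    qed
  qed
qed

lemma simple_invol [simp]: "simple i \<circ> simple i = id" "simple i \<circ> (simple i \<circ> p) = p"
  by (auto simp: simple_def fun_eq_iff)

lemma braid: "simple 2 \<circ> simple 1 \<circ> simple 2 = w0"
  by (rule ext) (simp add: simple_apply)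

lemma S3_distinct:
  "s1 \<noteq> id" "s2 \<noteq> id" "w12 \<noteq> id" "w21 \<noteq> id" "w0 \<noteq> id"
  "s1 \<noteq> s2" "s1 \<noteq> w12" "s1 \<noteq> w21" "s1 \<noteq> w0"
  "s2 \<noteq> w12" "s2 \<noteq> w21" "s2 \<noteq> w0" "w12 \<noteq> w21" "w12 \<noteq> w0" "w21 \<noteq> w0"
proof -
  have *: "p \<noteq> q" if "p 1 \<noteq> q 1 \<or> p 2 \<noteq> q 2 \<or> p 3 \<noteq> (q 3)" for p q :: perm3
    using that by auto
  show "s1 \<noteq> id" "s2 \<noteq> id" "w12 \<noteq> id" "w21 \<noteq> id" "w0 \<noteq> id"
  "s1 \<noteq> s2" "s1 \<noteq> w12" "s1 \<noteq> w21" "s1 \<noteq> w0"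
  "s2 \<noteq> w12" "s2 \<noteq> w21" "s2 \<noteq> w0" "w12 \<noteq> w21" "w12 \<noteq> w0" "w21 \<noteq> w0"
    by (rule *; simp add: simple_apply)+
qed

lemma finite_S3: "finite S3"
  by (simp add: S3_eq)

lemma sum_S3: "(\<Sum>w\<in>S3. f w) = f id + f s1 + f s2 + f w12 + f w21 + f w0"
  for f :: "perm3 \<Rightarrow> 'a::comm_monoid_add"
  unfolding S3_eq using S3_distinct by (simp add: S3_distinct[symmetric] add.assoc del: One_nat_def)

context
  notes One_nat_def [simp del]
begin

lemma S3_table:
  "s1 \<circ> id = s1" "s1 \<circ> s1 = id" "s1 \<circ> w12 = s2" "s1 \<circ> w21 = w0" "s1 \<circ> w0 = w21"
  "s2 \<circ> id = s2" "s2 \<circ> s2 = id" "s2 \<circ> w12 = w0" "s2 \<circ> w21 = s1" "s2 \<circ> w0 = w12"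
  by (rule ext; simp add: simple_apply)+

lemma S3_mem [simp]: "id \<in> S3" "s1 \<in> S3" "s2 \<in> S3" "w12 \<in> S3" "w21 \<in> S3" "w0 \<in> S3"
  by (simp_all add: S3_eq)

lemma words_cases:
  assumes "set is \<subseteq> {1, 2 :: nat}" "length is \<le> 3"
  shows "is \<in> {[], [1], [2], [1,1], [1,2], [2,1], [2,2], [1,1,1], [1,1,2], [1,2,1], [1,2,2],
                [2,1,1], [2,1,2], [2,2,1], [2,2,2]}"
proof -
  consider "is = []" | a where "is = [a]" | a b where "is = [a,b]" | a b c where "is = [a,b,c]"
    | a b c d r where "is = a # b # c # d # r"
    by (metis list.exhaust)
  then show ?thesis using assms by cases auto
qed

lemma word_prod_values:
  "word_prod [] = id" "word_prod [1] = s1" "word_prod [2] = s2" "word_prod [1,1] = id"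
  "word_prod [1,2] = w12" "word_prod [2,1] = w21" "word_prod [2,2] = id" "word_prod [1,1,1] = s1"
  "word_prod [1,1,2] = s2" "word_prod [1,2,1] = w0" "word_prod [1,2,2] = s1"
  "word_prod [2,1,1] = s2" "word_prod [2,1,2] = w0" "word_prod [2,2,1] = s1" "word_prod [2,2,2] = s2"
  by (rule ext; simp add: simple_apply word_prod_def)+

lemma len_least: "set is \<subseteq> {1, 2} \<Longrightarrow> len (word_prod is) \<le> length is"
  unfolding len_def by (rule Least_le) blast

lemma reduced_word_spec:
  assumes "w \<in> S3"
  shows "set (reduced_word w) \<subseteq> {1, 2}" "word_prod (reduced_word w) = w"
    "length (reduced_word w) = len w" "len w \<le> 3"
proof -
  have "\<exists>is. set is \<subseteq> {1, 2} \<and> length is \<le> 3 \<and> word_prod is = w"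
  proof -
    have "w \<in> word_prod ` {[], [1], [2], [1,2], [2,1], [1,2,1]}"
      using assms by (simp add: S3_eq word_prod_values)
    then obtain ws where "ws \<in> {[], [1], [2], [1,2], [2,1], [1,2,1]}" "w = word_prod ws"
      by (rule imageE)
    then show ?thesis by (intro exI[of _ ws]) auto
  qed
  then obtain is0 where is0: "set is0 \<subseteq> {1, 2}" "length is0 \<le> 3" "word_prod is0 = w" by blast
  have "\<exists>is. set is \<subseteq> {1, 2} \<and> length is = len w \<and> word_prod is = w"
    unfolding len_def by (rule LeastI_ex) (use is0 in blast)
  then have "\<exists>is. set is \<subseteq> {1, 2} \<and> word_prod is = w \<and> length is = len w" by blast
  from someI_ex[OF this, folded reduced_word_def]
  show "set (reduced_word w) \<subseteq> {1, 2}" "word_prod (reduced_word w) = w"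
    "length (reduced_word w) = len w" by blast+
  show "len w \<le> 3" using len_least[OF is0(1)] is0 by simp
qed

lemma reduced_word_enum:
  assumes "w \<in> S3"
  shows "reduced_word w \<in> {[], [1], [2], [1,1], [1,2], [2,1], [2,2], [1,1,1], [1,1,2], [1,2,1],
           [1,2,2], [2,1,1], [2,1,2], [2,2,1], [2,2,2]}"
  using reduced_word_spec[OF assms] by (intro words_cases) simp_all

lemmas S3_distinct' = S3_distinct S3_distinct[symmetric]

lemma len_values: "len id = 0" "len s1 = 1" "len s2 = 1" "len w12 = 2" "len w21 = 2" "len w0 = 3"
  and reduced_word_values: "reduced_word id = []" "reduced_word s1 = [1]" "reduced_word s2 = [2]"
    "reduced_word w12 = [1,2]" "reduced_word w21 = [2,1]"
    "reduced_word w0 = [1,2,1] \<or> reduced_word w0 = [2,1,2]"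
proof -
  have le: "len id \<le> 0" "len s1 \<le> 1" "len s2 \<le> 1" "len w12 \<le> 2" "len w21 \<le> 2" "len w0 \<le> 3"
    using len_least[of "[]"] len_least[of "[1]"] len_least[of "[2]"] len_least[of "[1,2]"]
      len_least[of "[2,1]"] len_least[of "[1,2,1]"]
    by (simp_all add: word_prod_values)
  show r: "reduced_word id = []" "reduced_word s1 = [1]" "reduced_word s2 = [2]"
    "reduced_word w12 = [1,2]" "reduced_word w21 = [2,1]"
    "reduced_word w0 = [1,2,1] \<or> reduced_word w0 = [2,1,2]"
    subgoal using reduced_word_enum[OF S3_mem(1)] reduced_word_spec(2,3)[OF S3_mem(1)] le(1)
      unfolding insert_iff empty_iff by (elim disjE; simp add: word_prod_values S3_distinct')
    subgoal using reduced_word_enum[OF S3_mem(2)] reduced_word_spec(2,3)[OF S3_mem(2)] le(2)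
      unfolding insert_iff empty_iff by (elim disjE; simp add: word_prod_values S3_distinct')
    subgoal using reduced_word_enum[OF S3_mem(3)] reduced_word_spec(2,3)[OF S3_mem(3)] le(3)
      unfolding insert_iff empty_iff by (elim disjE; simp add: word_prod_values S3_distinct')
    subgoal using reduced_word_enum[OF S3_mem(4)] reduced_word_spec(2,3)[OF S3_mem(4)] le(4)
      unfolding insert_iff empty_iff by (elim disjE; simp add: word_prod_values S3_distinct')
    subgoal using reduced_word_enum[OF S3_mem(5)] reduced_word_spec(2,3)[OF S3_mem(5)] le(5)
      unfolding insert_iff empty_iff by (elim disjE; simp add: word_prod_values S3_distinct')
    subgoal using reduced_word_enum[OF S3_mem(6)] reduced_word_spec(2,3)[OF S3_mem(6)] le(6)
      unfolding insert_iff empty_iff by (elim disjE; simp add: word_prod_values S3_distinct')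
    done
  show "len id = 0" "len s1 = 1" "len s2 = 1" "len w12 = 2" "len w21 = 2" "len w0 = 3"
    using r reduced_word_spec(3)[of id] reduced_word_spec(3)[of s1] reduced_word_spec(3)[of s2]
      reduced_word_spec(3)[of w12] reduced_word_spec(3)[of w21] reduced_word_spec(3)[of w0]
    by (simp_all, elim disjE, simp_all)
qed

lemma u_nonzero: "u \<noteq> 0"
  by (simp add: u_def Zero_fract_def eq_fract)

lemma simple_comp_S3: "i \<in> {1, 2} \<Longrightarrow> w \<in> S3 \<Longrightarrow> simple i \<circ> w \<in> S3"
  unfolding S3_eq using S3_table braid by auto

lemma lmul_id: "lmul 1 h id = h s1" "lmul 2 h id = h s2"
  by (simp_all only: lmul_def S3_table S3_mem len_values if_True if_False) simp_all

lemma lmul_values: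
  "lmul 1 h s1 = h id + (u - inverse u) * h s1" "lmul 1 h s2 = h w12"
  "lmul 1 h w12 = h s2 + (u - inverse u) * h w12" "lmul 1 h w21 = h w0"
  "lmul 1 h w0 = h w21 + (u - inverse u) * h w0"
  "lmul 2 h s1 = h w21" "lmul 2 h s2 = h id + (u - inverse u) * h s2"
  "lmul 2 h w12 = h w0" "lmul 2 h w21 = h s1 + (u - inverse u) * h w21"
  "lmul 2 h w0 = h w12 + (u - inverse u) * h w0"
  by (simp_all only: lmul_def S3_table S3_mem len_values if_True if_False) simp_all

lemma lmul_outside: "w \<notin> S3 \<Longrightarrow> lmul i h w = 0"
  by (simp add: lmul_def)

lemma S3_ext:
  assumes "\<And>w. w \<notin> S3 \<Longrightarrow> g w = h w" "g id = h id" "g s1 = h s1" "g s2 = h s2"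
    "g w12 = h w12" "g w21 = h w21" "g w0 = h w0"
  shows "g = h"
proof
  fix w show "g w = h w" using assms by (cases "w \<in> S3") (auto simp: S3_eq)
qed

lemma lmul_braid: "lmul 2 (lmul 1 (lmul 2 h)) = lmul 1 (lmul 2 (lmul 1 h))"
  by (rule S3_ext) (simp_all only: lmul_outside lmul_id lmul_values simp_thms, simp_all add: algebra_simps)

lemma hmult_eq:
  "hmult g h x = g id * h x + g s1 * lmul 1 h x + g s2 * lmul 2 h x + g w12 * lmul 1 (lmul 2 h) x
     + g w21 * lmul 2 (lmul 1 h) x + g w0 * lmul 1 (lmul 2 (lmul 1 h)) x"
proof -
  have "foldr lmul (reduced_word w0) h = lmul 1 (lmul 2 (lmul 1 h))"
    using reduced_word_values(6) by (auto simp: lmul_braid)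
  then show ?thesis
    unfolding hmult_def sum_S3 by (simp only: reduced_word_values(1-5)) simp
qed

lemma hmult_bilinear:
  "hmult (\<lambda>x. c * g x + g' x) h = (\<lambda>x. c * hmult g h x + hmult g' h x)"
  "hmult g (\<lambda>x. c * h x + h' x) = (\<lambda>x. c * hmult g h x + hmult g h' x)"
proof -
  show "hmult (\<lambda>x. c * g x + g' x) h = (\<lambda>x. c * hmult g h x + hmult g' h x)"
    by (rule ext) (simp add: hmult_eq algebra_simps)
  have "lmul i (\<lambda>x. c * h x + h' x) = (\<lambda>x. c * lmul i h x + lmul i h' x)" for i h h'
    by (rule ext) (simp add: lmul_def algebra_simps)
  then show "hmult g (\<lambda>x. c * h x + h' x) = (\<lambda>x. c * hmult g h x + hmult g h' x)"
    by (intro ext) (simp add: hmult_eq algebra_simps)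
qed

lemma hmult_T:
  assumes "v \<in> S3"
  shows "hmult (T v) h = foldr lmul (reduced_word v) h"
  using assms by (auto simp: hmult_def T_def if_distrib[of "\<lambda>c. c * _"] finite_S3 cong: if_cong)

lemma hmult_T_id: "hmult (T id) h = h"
  by (simp add: hmult_T reduced_word_values)

lemma hmult_T_simple: "i \<in> {1, 2} \<Longrightarrow> hmult (T (simple i)) h = lmul i h"
  by (auto simp: hmult_T reduced_word_values)

lemma lmul_T:
  assumes "w \<in> S3" "i \<in> {1, 2}" "len (simple i \<circ> w) > len w"
  shows "lmul i (T w) = T (simple i \<circ> w)"
proof
  fix x
  have "simple i \<circ> x = w \<longleftrightarrow> x = simple i \<circ> w" by (metis simple_invol(2))
  then show "lmul i (T w) x = T (simple i \<circ> w) x"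
    using assms simple_comp_S3[of i w] by (auto simp: lmul_def T_def)
qed

lemma len_simple_le: "w \<in> S3 \<Longrightarrow> i \<in> {1, 2} \<Longrightarrow> len (simple i \<circ> w) \<le> Suc (len w)"
  using len_least[of "i # reduced_word w"] reduced_word_spec[of w] by (simp add: word_prod_def)

theorem T_mult_T:
  assumes "v \<in> S3" "w \<in> S3" "len (v \<circ> w) = len v + len w"
  shows "hmult (T v) (T w) = T (v \<circ> w)"
proof -
  have "(len (word_prod is \<circ> w) \<le> length is + len w) \<and> word_prod is \<circ> w \<in> S3 \<and>
        (len (word_prod is \<circ> w) = length is + len w \<longrightarrow> foldr lmul is (T w) = T (word_prod is \<circ> w))"
    if "set is \<subseteq> {1, 2}" for "is" using that
  proof (induction "is")
    case Nil then show ?case using assms by (simp add: word_prod_def)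
  next
    case (Cons i js)
    have js: "i \<in> {1, 2}" "set js \<subseteq> {1, 2}"
      using Cons.prems by (simp_all only: list.set insert_subset)
    let ?y = "word_prod js \<circ> w"
    have IH: "len ?y \<le> length js + len w" "?y \<in> S3"
        "len ?y = length js + len w \<longrightarrow> foldr lmul js (T w) = T ?y"
      using Cons.IH[OF js(2)] by blast+
    have eq: "word_prod (i # js) \<circ> w = simple i \<circ> ?y" by (simp add: word_prod_def comp_assoc)
    have le: "len (simple i \<circ> ?y) \<le> Suc (len ?y)" by (rule len_simple_le[OF IH(2) js(1)])
    have "foldr lmul (i # js) (T w) = T (simple i \<circ> ?y)"
      if "len (simple i \<circ> ?y) = length (i # js) + len w"
    proof -
      have "len ?y = length js + len w" "len (simple i \<circ> ?y) > len ?y"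
        using that le IH(1) by simp_all
      then show ?thesis using IH(3) lmul_T[OF IH(2) js(1)] by simp
    qed
    moreover have "len (simple i \<circ> ?y) \<le> length (i # js) + len w"
      using le IH(1) by simp
    ultimately show ?case
      unfolding eq using simple_comp_S3[OF js(1) IH(2)] by blast
  qed
  from this[of "reduced_word v"] show ?thesis
    using reduced_word_spec[OF assms(1)] assms(3) hmult_T[OF assms(1)] by simp
qed

theorem T_quadratic: "i \<in> {1, 2} \<Longrightarrow> hmult (C_minus i) (C_plus i) = (\<lambda>_. 0)"
proof -
  assume i: "i \<in> {1, 2}"
  have 1: "C_minus i = (\<lambda>x. - u * T id x + T (simple i) x)" by (simp add: C_minus_def fun_eq_iff)
  have "lmul i (C_plus i) = (\<lambda>x. u * C_plus i x)"
    using i u_nonzero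
    by (elim insertE emptyE; hypsubst; intro S3_ext)
      (simp_all only: lmul_id lmul_values lmul_outside C_plus_def T_def S3_distinct' simp_thms if_True if_False,
       auto simp: field_simps)
  then show ?thesis
    unfolding 1 hmult_bilinear(1) hmult_T_id hmult_T_simple[OF i] by simp
qed

theorem hmult_assoc: "hmult (hmult f g) h = hmult f (hmult g h)" if "\<And>w. w \<notin> S3 \<Longrightarrow> h w = 0"
proof -
  have lin: "lmul i (\<lambda>x. c * h x + h' x) = (\<lambda>x. c * lmul i h x + lmul i h' x)" for i c h h'
    by (rule ext) (simp add: lmul_def algebra_simps)
  have *: "hmult (lmul i g) h = lmul i (hmult g h)" if i: "i \<in> {1, 2}" for i g
    using i \<open>\<And>w. w \<notin> S3 \<Longrightarrow> h w = 0\<close>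
    by (elim insertE emptyE; hypsubst; intro S3_ext)
      (simp_all only: lmul_id lmul_values hmult_eq lmul_outside simp_thms, simp_all add: algebra_simps)
  have "hmult (hmult f g) h = (\<lambda>x. f id * hmult g h x + (f s1 * hmult (lmul 1 g) h x
     + (f s2 * hmult (lmul 2 g) h x + (f w12 * hmult (lmul 1 (lmul 2 g)) h x
     + (f w21 * hmult (lmul 2 (lmul 1 g)) h x + f w0 * hmult (lmul 1 (lmul 2 (lmul 1 g))) h x)))))"
    by (rule ext) (simp add: hmult_eq[of f] hmult_eq[of _ h] algebra_simps)
  also have "\<dots> = hmult f (hmult g h)"
    by (rule ext) (simp add: * hmult_eq[of f] algebra_simps)
  finally show ?thesis .
qed

lemma eps_C_plus: "i \<in> {1, 2} \<Longrightarrow> eps (C_plus i) = two"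
  by (elim insertE emptyE; simp only: eps_def sum_S3 eps_T_def len_values C_plus_def T_def
     S3_distinct' simp_thms if_True if_False two_def; simp)

theorem eps_hmult: "eps (hmult g h) = eps g * eps h"
  using u_nonzero unfolding eps_def sum_S3
  by (simp only: hmult_eq lmul_id lmul_values eps_T_def len_values)
    (simp add: field_simps power2_eq_square power3_eq_cube)

end


section \<open>Tensor powers\<close>

text \<open>The \<open>k\<close>-th tensor power of \<open>K \<otimes> H\<^sub>3\<close> has the basis \<open>T\<^sub>x\<^sub>1 \<otimes> \<dots> \<otimes> T\<^sub>x\<^sub>k\<close> indexed by \<open>tuples k\<close>; an element
  is again the family of its coefficients, extended by zero. The tensor power of \<open>H\<^sub>3\<close> over the Laurent
  polynomials consists of the families with coefficients in \<^const>\<open>laurent\<close>.\<close>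

type_synonym tensor = "perm3 list \<Rightarrow> K"

definition tuples :: "nat \<Rightarrow> perm3 list set" where
  "tuples k = {xs. length xs = k \<and> set xs \<subseteq> S3}"

definition smul :: "K \<Rightarrow> tensor \<Rightarrow> tensor" where
  "smul c f = (\<lambda>x. c * f x)"

interpretation tensor: vector_space smul
  by unfold_locales (simp_all add: smul_def fun_eq_iff algebra_simps)

definition pure :: "hecke list \<Rightarrow> tensor" where
  "pure hs = (\<lambda>x. if x \<in> tuples (length hs) then \<Prod>i<length hs. (hs ! i) (x ! i) else 0)"

definition tone :: "nat \<Rightarrow> tensor" where
  "tone k = pure (replicate k (T id))"

definition tmult :: "nat \<Rightarrow> tensor \<Rightarrow> tensor \<Rightarrow> tensor" where
  "tmult k f g = (\<lambda>z. if z \<in> tuples k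
     then \<Sum>x\<in>tuples k. \<Sum>y\<in>tuples k. f x * g y * (\<Prod>i<k. hmult (T (x ! i)) (T (y ! i)) (z ! i))
     else 0)"

lemma tuples_Suc: "tuples (Suc k) = (\<lambda>(v, x). v # x) ` (S3 \<times> tuples k)"
  by (force simp: tuples_def length_Suc_conv image_iff)

lemma finite_tuples: "finite (tuples k)"
  by (induction k) (simp_all add: tuples_Suc finite_S3, simp add: tuples_def)

lemma sum_tuples_prod:
  "(\<Sum>x\<in>tuples k. \<Prod>i<k. F i (x ! i)) = (\<Prod>i<k. \<Sum>v\<in>S3. (F i v :: K))"
proof (induction k arbitrary: F)
  case 0
  have "tuples 0 = {[]}" by (auto simp: tuples_def)
  then show ?case by simp
next
  case (Suc k)
  have "(\<Sum>x\<in>tuples (Suc k). \<Prod>i<Suc k. F i (x ! i)) =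
        (\<Sum>(v, x)\<in>S3 \<times> tuples k. \<Prod>i<Suc k. F i ((v # x) ! i))"
    unfolding tuples_Suc by (subst sum.reindex) (auto simp: inj_on_def case_prod_beta)
  also have "\<dots> = (\<Sum>v\<in>S3. F 0 v) * (\<Sum>x\<in>tuples k. \<Prod>i<k. F (Suc i) (x ! i))"
    unfolding prod.lessThan_Suc_shift
    by (simp add: sum.cartesian_product sum_product)
  finally show ?case
    using Suc.IH[of "\<lambda>i. F (Suc i)"] by (simp add: prod.lessThan_Suc_shift del: prod.lessThan_Suc)
qed

lemma hmult_expand:
  assumes "z \<in> S3"
  shows "hmult g h z = (\<Sum>v\<in>S3. \<Sum>w\<in>S3. g v * h w * hmult (T v) (T w) z)"
proof -
  have *: "foldr lmul ws h z = (\<Sum>w\<in>S3. h w * foldr lmul ws (T w) z)"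
    if "set ws \<subseteq> {1, 2}" "z \<in> S3" for ws z
    using that
  proof (induction ws arbitrary: z)
    case Nil
    then show ?case by (simp add: T_def if_distrib[of "\<lambda>c. _ * c"] finite_S3 cong: if_cong)
  next
    case (Cons i js)
    then have "simple i \<circ> z \<in> S3" by (intro simple_comp_S3) auto
    with Cons show ?case
      by (simp add: lmul_def[of i] sum_distrib_left sum.distrib algebra_simps)
  qed
  show ?thesis
    unfolding hmult_def[of g]
    by (intro sum.cong refl)
      (simp add: *[OF reduced_word_spec(1) assms] hmult_T sum_distrib_left mult.assoc)
qed

theorem tmult_pure:
  assumes "length fs = k" "length gs = k"
  shows "tmult k (pure fs) (pure gs) = pure (map2 hmult fs gs)"
proof
  fix z
  show "tmult k (pure fs) (pure gs) z = pure (map2 hmult fs gs) z"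
  proof (cases "z \<in> tuples k")
    case True
    then have z: "z ! i \<in> S3" if "i < k" for i using that by (auto simp: tuples_def)
    have "tmult k (pure fs) (pure gs) z = (\<Sum>x\<in>tuples k. \<Sum>y\<in>tuples k. \<Prod>i<k.
        (fs ! i) (x ! i) * (gs ! i) (y ! i) * hmult (T (x ! i)) (T (y ! i)) (z ! i))"
      using True assms by (simp add: tmult_def pure_def prod.distrib)
    also have "\<dots> = (\<Prod>i<k. \<Sum>v\<in>S3. \<Sum>w\<in>S3. (fs ! i) v * (gs ! i) w * hmult (T v) (T w) (z ! i))"
      by (simp only: sum_tuples_prod[where F = "\<lambda>i w. (fs ! i) (x ! i) * (gs ! i) w * hmult (T (x ! i)) (T w) (z ! i)" for x]
        sum_tuples_prod[where F = "\<lambda>i v. \<Sum>w\<in>S3. (fs ! i) v * (gs ! i) w * hmult (T v) (T w) (z ! i)"])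
    also have "\<dots> = (\<Prod>i<k. hmult (fs ! i) (gs ! i) (z ! i))"
      by (intro prod.cong refl) (simp add: hmult_expand[OF z, symmetric])
    finally show ?thesis using True assms by (simp add: pure_def)
  next
    case False
    then show ?thesis using assms by (simp add: tmult_def pure_def)
  qed
qed


section \<open>The algebras generated by the elements \<open>P\<^sub>i\<close>\<close>

text \<open>A sign vector is a list of Booleans, \<^const>\<open>True\<close> standing for \<open>+\<close>.\<close>

definition P :: "nat \<Rightarrow> nat \<Rightarrow> tensor" where
  "P k i = (\<Sum>a | length a = k \<and> even (count_list a False).
              pure (map (\<lambda>b. if b then C_plus i else C_minus i) a))"

inductive_set check_H :: "nat \<Rightarrow> tensor set" for k :: nat where
  one: "tone k \<in> check_H k"
| gen: "i \<in> {1, 2} \<Longrightarrow> P k i \<in> check_H k"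
| add: "f \<in> check_H k \<Longrightarrow> g \<in> check_H k \<Longrightarrow> f + g \<in> check_H k"
| smul: "c \<in> laurent \<Longrightarrow> f \<in> check_H k \<Longrightarrow> smul c f \<in> check_H k"
| mult: "f \<in> check_H k \<Longrightarrow> g \<in> check_H k \<Longrightarrow> tmult k f g \<in> check_H k"

text \<open>Since \<open>K\<close> is flat over the Laurent polynomials, the base change of \<open>check_H k\<close> to \<open>K\<close> embeds into
  that of the tensor power of \<open>H\<^sub>3\<close>, with image the \<open>K\<close>-span.\<close>

definition K_check_H :: "nat \<Rightarrow> tensor set" where
  "K_check_H k = tensor.span (check_H k)"


section \<open>Representations\<close>

definition is_rep :: "nat \<Rightarrow> (K \<Rightarrow> 'v \<Rightarrow> 'v) \<Rightarrow> (tensor \<Rightarrow> 'v \<Rightarrow> 'v::ab_group_add) \<Rightarrow> bool" where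
  "is_rep k sc \<rho> \<longleftrightarrow>
     vector_space sc \<and>
     (\<forall>h\<in>K_check_H k. Vector_Spaces.linear sc sc (\<rho> h)) \<and>
     (\<forall>v. \<rho> (tone k) v = v) \<and>
     (\<forall>g\<in>K_check_H k. \<forall>h\<in>K_check_H k. \<forall>v. \<rho> (g + h) v = \<rho> g v + \<rho> h v) \<and>
     (\<forall>g\<in>K_check_H k. \<forall>h\<in>K_check_H k. \<forall>v. \<rho> (tmult k g h) v = \<rho> g (\<rho> h v)) \<and>
     (\<forall>c. \<forall>h\<in>K_check_H k. \<forall>v. \<rho> (smul c h) v = sc c (\<rho> h v))"

definition is_irrep :: "nat \<Rightarrow> (K \<Rightarrow> 'v \<Rightarrow> 'v) \<Rightarrow> (tensor \<Rightarrow> 'v \<Rightarrow> 'v::ab_group_add) \<Rightarrow> bool" where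
  "is_irrep k sc \<rho> \<longleftrightarrow>
     is_rep k sc \<rho> \<and> (\<exists>v::'v. v \<noteq> 0) \<and>
     (\<forall>W. module.subspace sc W \<and> (\<forall>h\<in>K_check_H k. \<forall>v\<in>W. \<rho> h v \<in> W) \<longrightarrow> W = {0} \<or> W = UNIV)"

definition rep_iso :: "nat \<Rightarrow> (K \<Rightarrow> 'v \<Rightarrow> 'v) \<Rightarrow> (tensor \<Rightarrow> 'v \<Rightarrow> 'v::ab_group_add) \<Rightarrow>
    (K \<Rightarrow> 'w \<Rightarrow> 'w) \<Rightarrow> (tensor \<Rightarrow> 'w \<Rightarrow> 'w::ab_group_add) \<Rightarrow> bool" where
  "rep_iso k sc \<rho> sc' \<sigma> \<longleftrightarrow>
     (\<exists>\<phi>. Vector_Spaces.linear sc sc' \<phi> \<and> bij \<phi> \<and>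
        (\<forall>h\<in>K_check_H k. \<forall>v. \<phi> (\<rho> h v) = \<sigma> h (\<phi> v)))"

text \<open>The algebra being generated by \<open>P k 1\<close> and \<open>P k 2\<close>, there is on \<open>K_check_H k\<close> at most one
  representation with prescribed values at these two elements; the descriptions by \<open>SOME\<close> below
  select it, provided that it exists.\<close>

definition extends_to_rep ::
    "nat \<Rightarrow> (K \<Rightarrow> 'v \<Rightarrow> 'v) \<Rightarrow> ('v \<Rightarrow> 'v) \<Rightarrow> ('v \<Rightarrow> 'v) \<Rightarrow> (tensor \<Rightarrow> 'v \<Rightarrow> 'v::ab_group_add) \<Rightarrow> bool" where
  "extends_to_rep k sc A1 A2 \<rho> \<longleftrightarrow> is_rep k sc \<rho> \<and> \<rho> (P k 1) = A1 \<and> \<rho> (P k 2) = A2"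

definition is_check_eps_plus :: "nat \<Rightarrow> (tensor \<Rightarrow> K \<Rightarrow> K) \<Rightarrow> bool" where
  "is_check_eps_plus k = extends_to_rep k (*) (\<lambda>v. two ^ k * v) (\<lambda>v. two ^ k * v)"

definition is_check_eps_minus :: "nat \<Rightarrow> (tensor \<Rightarrow> K \<Rightarrow> K) \<Rightarrow> bool" where
  "is_check_eps_minus k = extends_to_rep k (*) (\<lambda>v. 0) (\<lambda>v. 0)"

definition is_check_X :: "nat \<Rightarrow> K \<Rightarrow> (tensor \<Rightarrow> K^2 \<Rightarrow> K^2) \<Rightarrow> bool" where
  "is_check_X k c = extends_to_rep k (*s)
     ((*v) (vector [vector [two ^ k, c], vector [0, 0]] :: K^2^2))
     ((*v) (vector [vector [0, 0], vector [1, two ^ k]] :: K^2^2))"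

definition check_eps_plus :: "nat \<Rightarrow> tensor \<Rightarrow> K \<Rightarrow> K" where
  "check_eps_plus k = (SOME \<rho>. is_check_eps_plus k \<rho>)"

definition check_eps_minus :: "nat \<Rightarrow> tensor \<Rightarrow> K \<Rightarrow> K" where
  "check_eps_minus k = (SOME \<rho>. is_check_eps_minus k \<rho>)"

definition check_X :: "nat \<Rightarrow> K \<Rightarrow> tensor \<Rightarrow> K^2 \<Rightarrow> K^2" where
  "check_X k c = (SOME \<rho>. is_check_X k c \<rho>)"

definition check_M :: "nat \<Rightarrow> tensor \<Rightarrow> K^2 \<Rightarrow> K^2" where
  "check_M j = check_X j ((two ^ j * a_cheb j)\<^sup>2)"

text \<open>For \<open>j \<le> k\<close>, \<open>eps_contract k j\<close> is the \<open>K\<close>-linear map \<open>\<epsilon>\<^sub>+ \<otimes> \<dots> \<otimes> \<epsilon>\<^sub>+ \<otimes> id\<close> from the \<open>k\<close>-th to the \<open>j\<close>-th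
  tensor power, with \<open>k - j\<close> factors \<open>\<epsilon>\<^sub>+\<close>. Identifying \<open>K \<otimes> M\<close> with \<open>M\<close>, an element \<open>\<Sum> g \<otimes> h\<close> acts on the
  tensor product of the one-dimensional module \<open>\<epsilon>\<^sub>+ \<otimes> \<dots> \<otimes> \<epsilon>\<^sub>+\<close> with \<open>M\<close> as \<open>\<Sum> \<epsilon>\<^sub>+(g) h\<close> acts on \<open>M\<close>.\<close>

definition eps_contract :: "nat \<Rightarrow> nat \<Rightarrow> tensor \<Rightarrow> tensor" where
  "eps_contract k j f = (\<lambda>y. if y \<in> tuples j
     then \<Sum>x\<in>tuples (k - j). (\<Prod>i<k - j. eps_T (x ! i)) * f (x @ y) else 0)"

definition eps_tensor :: "nat \<Rightarrow> nat \<Rightarrow> (tensor \<Rightarrow> 'v \<Rightarrow> 'v) \<Rightarrow> tensor \<Rightarrow> 'v \<Rightarrow> 'v" where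
  "eps_tensor k j \<rho> h = \<rho> (eps_contract k j h)"

lemma eps_C_minus: "i \<in> {1, 2} \<Longrightarrow> eps (C_minus i) = 0"
proof -
  assume i: "i \<in> {1, 2}"
  have "C_minus i = (\<lambda>x. C_plus i x - two * T id x)"
    by (simp add: C_plus_def C_minus_def two_def algebra_simps)
  moreover have "eps (T id) = 1"
    by (simp add: eps_def T_def if_distrib[of "\<lambda>c. c * _"] finite_S3 S3_mem eps_T_def len_values cong: if_cong)
  ultimately show ?thesis
    using eps_C_plus[OF i] by (simp add: eps_def algebra_simps sum_subtractf sum_distrib_left[symmetric])
qed

lemma eps_contract_pure:
  assumes "length gs = k - j" "length hs = j" "j \<le> k"
  shows "eps_contract k j (pure (gs @ hs)) = smul (\<Prod>i<k - j. eps (gs ! i)) (pure hs)"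
proof
  fix y
  show "eps_contract k j (pure (gs @ hs)) y = smul (\<Prod>i<k - j. eps (gs ! i)) (pure hs) y"
  proof (cases "y \<in> tuples j")
    case True
    have split: "pure (gs @ hs) (x @ y) = (\<Prod>i<k - j. (gs ! i) (x ! i)) * pure hs y"
      if x: "x \<in> tuples (k - j)" for x
    proof -
      have "{..<k} = {..<k - j} \<union> {k - j..<k}" using assms by auto
      then have "(\<Prod>i<k. ((gs @ hs) ! i) ((x @ y) ! i)) =
          (\<Prod>i<k - j. ((gs @ hs) ! i) ((x @ y) ! i)) * (\<Prod>i=k - j..<k. ((gs @ hs) ! i) ((x @ y) ! i))"
        by (simp add: prod.union_disjoint ivl_disj_int)
      also have "(\<Prod>i=k - j..<k. ((gs @ hs) ! i) ((x @ y) ! i)) = (\<Prod>i<j. (hs ! i) (y ! i))"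
        using assms x True
        by (intro prod.reindex_bij_witness[of _ "\<lambda>i. i + (k - j)" "\<lambda>i. i - (k - j)"])
          (auto simp: tuples_def nth_append)
      also have "(\<Prod>i<k - j. ((gs @ hs) ! i) ((x @ y) ! i)) = (\<Prod>i<k - j. (gs ! i) (x ! i))"
        using assms x by (intro prod.cong) (auto simp: tuples_def nth_append)
      finally show ?thesis using assms x True by (auto simp: pure_def tuples_def)
    qed
    have "eps_contract k j (pure (gs @ hs)) y =
        (\<Sum>x\<in>tuples (k - j). (\<Prod>i<k - j. (gs ! i) (x ! i) * eps_T (x ! i)) * pure hs y)"
      using True unfolding eps_contract_def
      by (simp add: split prod.distrib mult_ac cong: sum.cong)
    also have "\<dots> = (\<Prod>i<k - j. eps (gs ! i)) * pure hs y"
      unfolding eps_def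
      by (simp only: sum_distrib_right[symmetric]
          sum_tuples_prod[where F = "\<lambda>i v. (gs ! i) v * eps_T v"])
    finally show ?thesis by (simp add: smul_def)
  next
    case False
    then show ?thesis using assms by (simp add: eps_contract_def smul_def pure_def)
  qed
qed

lemma eps_contract_sum: "eps_contract k j (\<Sum>a\<in>A. f a) = (\<Sum>a\<in>A. eps_contract k j (f a))"
proof (induction A rule: infinite_finite_induct)
  case (insert a A)
  have "eps_contract k j (f + g) = eps_contract k j f + eps_contract k j g" for f g
    by (rule ext) (simp add: eps_contract_def algebra_simps sum.distrib)
  with insert(3) show ?case by (simp only: sum.insert[OF insert(1,2)])
qed (simp_all add: eps_contract_def fun_eq_iff)

theorem eps_contract_P:
  assumes "i \<in> {1, 2}" "j \<le> k"
  shows "eps_contract k j (P k i) = smul (two ^ (k - j)) (P j i)"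
proof -
  let ?c = "\<lambda>b. if b then C_plus i else C_minus i"
  let ?A = "\<lambda>n. {a. length a = n \<and> even (count_list a False)}"
  let ?e = "\<lambda>a. smul (\<Prod>n<k - j. eps (?c (a ! n))) (pure (map ?c (drop (k - j) a)))"
  let ?r = "\<lambda>b. replicate (k - j) True @ b"
  have fin: "finite (?A n)" for n
    by (rule finite_subset[OF _ finite_lists_length_eq[of "UNIV :: bool set" n]]) auto
  have "eps_contract k j (pure (map ?c a)) = ?e a" if "a \<in> ?A k" for a
  proof -
    have "map ?c a = map ?c (take (k - j) a) @ map ?c (drop (k - j) a)"
      by (simp add: map_append[symmetric] del: map_append)
    moreover have "length (take (k - j) a) = k - j" "length (drop (k - j) a) = j"
      using that assms by simp_all
    ultimately show ?thesis
      using eps_contract_pure[of "map ?c (take (k - j) a)" k j "map ?c (drop (k - j) a)"] assms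
      by (simp cong: prod.cong_simp)
  qed
  then have "eps_contract k j (P k i) = (\<Sum>a\<in>?A k. ?e a)"
    unfolding P_def eps_contract_sum by (rule sum.cong[OF refl])
  also have "\<dots> = (\<Sum>a\<in>?r ` ?A j. ?e a)"
  proof (rule sum.mono_neutral_right[OF fin])
    have rep: "count_list (replicate n True) False = 0" for n by (induction n) simp_all
    show "?r ` ?A j \<subseteq> ?A k" using assms by (auto simp: rep)
    show "\<forall>a\<in>?A k - ?r ` ?A j. ?e a = 0"
    proof
      fix a assume a: "a \<in> ?A k - ?r ` ?A j"
      have "\<exists>n<k - j. \<not> a ! n"
      proof (rule ccontr)
        assume *: "\<not> (\<exists>n<k - j. \<not> a ! n)"
        have "take (k - j) a = replicate (k - j) True"
          using a * by (intro nth_equalityI) auto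
        then have eq: "a = ?r (drop (k - j) a)" by (metis append_take_drop_id)
        have "count_list a False = count_list (drop (k - j) a) False"
          by (subst eq) (simp add: rep)
        then have "drop (k - j) a \<in> ?A j" using a assms by simp
        with eq a show False by blast
      qed
      then have "(\<Prod>n<k - j. eps (?c (a ! n))) = 0"
        using eps_C_minus[OF assms(1)] by (auto intro!: bexI)
      then show "?e a = 0" by (simp add: smul_def fun_eq_iff)
    qed
  qed
  also have "\<dots> = (\<Sum>b\<in>?A j. ?e (?r b))"
    by (subst sum.reindex) (auto simp: inj_on_def)
  also have "\<dots> = (\<Sum>b\<in>?A j. smul (two ^ (k - j)) (pure (map ?c b)))"
    using eps_C_plus[OF assms(1)] by (intro sum.cong refl) (simp add: nth_append)
  also have "\<dots> = smul (two ^ (k - j)) (P j i)"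
    by (simp only: P_def tensor.scale_sum_right)
  finally show ?thesis .
qed

end

theory Submission
  imports Defs
begin

text \<open>
  The elements \<open>R\<^sub>i = (C'\<^sub>i + C\<^sub>i) / [2]\<close> are involutions, and \<open>P\<^sub>i = [2]\<^sup>k (R\<^sub>i \<otimes> \<dots> \<otimes> R\<^sub>i + 1) / 2\<close>. So the algebra is
  a quotient of the group algebra of the infinite dihedral group, and the question is which eigenvalues
  \<open>G = R\<^sub>1 R\<^sub>2\<close> may have. On the two-dimensional representation of the Hecke algebra they are \<open>w\<close>, \<open>w\<^sup>-\<^sup>1\<close> with
  \<open>w + w\<^sup>-\<^sup>1 = 2 (2 / [2]\<^sup>2 - 1)\<close>, on the one-dimensional ones they are 1. The coefficients of \<open>(R\<^sub>1 R\<^sub>2)\<^sup>n\<close> in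
  the Hecke algebra are therefore combinations of \<open>1, w\<^sup>n, w\<^sup>-\<^sup>n\<close>, those of the \<open>n\<close>-th power of \<open>G\<close> in the tensor
  power are combinations of \<open>w\<^sup>m\<^sup>n\<close> with \<open>\<bar>m\<bar> \<le> k\<close>, and the product over \<open>j \<le> k\<close> of the factors
  \<open>G\<^sup>2 - 2 (2 a\<^sub>j\<^sup>2 - 1) G + 1\<close> vanishes. As \<open>G + G\<^sup>-\<^sup>1\<close> is central, it acts on an irreducible module by a scalar
  \<open>2 (2 a\<^sub>j\<^sup>2 - 1)\<close>, which for \<open>j \<ge> 1\<close> determines the module by Schur's lemma and for \<open>j = 0\<close> forces \<open>R\<^sub>1 = R\<^sub>2\<close>.

  Conversely, the Hecke algebra acts on the quadratic extension \<open>L = K(w)\<close>, with \<open>R\<^sub>1\<close> the conjugation and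
  \<open>R\<^sub>1 R\<^sub>2\<close> the multiplication by \<open>w\<close>. The multiplication map from the \<open>j\<close>-th tensor power of \<open>L\<close> to \<open>L\<close>
  intertwines the diagonal action of \<open>R\<^sub>1, R\<^sub>2\<close> with the conjugation and its twist by \<open>w\<^sup>j\<close>, so \<open>L\<close> becomes a
  module; in the basis \<open>1, P\<^sub>2 1\<close> it is \<open>check_M j\<close>.
\<close>

section \<open>Chebyshev values at \<open>1 / [2]\<close>\<close>

lemma u_pos: "u > 0"
  by (simp add: u_def zero_less_Fract_iff less_poly_def pos_poly_def)

lemma two_pos: "two > 0"
  using u_pos by (simp add: two_def add_pos_pos)

lemma two_nonzero [simp]: "two \<noteq> 0"
  using two_pos by simp

lemma a_cheb_0 [simp]: "a_cheb 0 = 1" and a_cheb_1: "a_cheb (Suc 0) = 1 / two"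
  and a_cheb_Suc_Suc: "a_cheb (Suc (Suc n)) = 2 * (1 / two) * a_cheb (Suc n) - a_cheb n"
  by (simp_all add: a_cheb_def)

text \<open>The Chebyshev recurrence at 1 / [2] = X / (X^2 + 1), homogenized so that the n-th value
  has denominator (X^2 + 1)^n.\<close>

fun cheb_numerator :: "nat \<Rightarrow> rat poly" where
  "cheb_numerator 0 = 1"
| "cheb_numerator (Suc 0) = [:0, 1:]"
| "cheb_numerator (Suc (Suc n)) = [:0, 2:] * cheb_numerator (Suc n) - [:1, 0, 1:]\<^sup>2 * cheb_numerator n"

lemma Fract_power: "Fract a b ^ n = Fract (a ^ n) (b ^ n)"
  by (induction n) (simp_all add: One_fract_def)

lemma one_over_two: "1 / two = Fract [:0, 1:] [:1, 0, 1:]"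
  by (simp add: two_def u_def One_fract_def eq_fract one_pCons)

lemma a_cheb_Fract: "a_cheb n = Fract (cheb_numerator n) ([:1, 0, 1:] ^ n)"
proof (induction n rule: cheb_numerator.induct)
  case (3 n)
  let ?p = "[:1, 0, 1:] :: rat poly"
  have p: "?p \<noteq> 0" by simp
  have 2: "(2 :: K) = Fract 2 1"
    by (metis One_fract_def add_fract mult_1 one_add_one one_neq_zero)
  have "a_cheb (Suc (Suc n)) = Fract (2 * [:0, 1:] * cheb_numerator (Suc n)) (?p * ?p ^ Suc n)
      - Fract (cheb_numerator n) (?p ^ n)"
    by (simp only: a_cheb_Suc_Suc one_over_two 3 2 mult_fract mult_1)
  also have "\<dots> = Fract (cheb_numerator (Suc (Suc n))) (?p ^ Suc (Suc n))"
  proof -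
    have "(2::rat poly) * [:0,1:] = [:0, 2:]" by (simp add: numeral_poly)
    then show ?thesis using p
      by (simp add: eq_fract del: mult_pCons_left mult_pCons_right) (simp add: algebra_simps power2_eq_square del: mult_pCons_left mult_pCons_right)
  qed
  finally show ?case .
qed (simp_all add: a_cheb_1 one_over_two One_fract_def[symmetric])

text \<open>Modulo X^2 + 1 the recurrence reads N_(n+2) = 2 X N_(n+1), and X is a unit
  there.\<close>

lemma cheb_numerator_not_dvd: "\<not> [:1, 0, 1:] dvd (cheb_numerator n)\<^sup>2"
proof -
  let ?p = "[:1, 0, 1:] :: rat poly" and ?X = "[:0, 1:] :: rat poly"
  have X: "?p dvd B" if "?p dvd ?X * B" for B
  proof -
    have "?p dvd ?X * (?X * B)" using that by (rule dvd_mult)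
    \<comment> \<open>Since X^2 = -1 modulo X^2 + 1, the inverse of X is -X.\<close>
    moreover have "B = ?p * B - ?X * (?X * B)" by (simp add: smult_add_left algebra_simps)
    ultimately show ?thesis by (metis dvd_diff dvd_triv_left)
  qed
  have one: "\<not> ?p dvd 1"
    by (metis degree_1 degree_pCons_eq_if dvd_imp_degree_le le_zero_eq one_neq_zero pCons_eq_0_iff zero_neq_numeral nat.simps(3))
  show ?thesis
  proof (induction n rule: cheb_numerator.induct)
    case 1 then show ?case using one by simp
  next
    case 2 then show ?case using one X[of "1"] X[of ?X] by (auto simp: power2_eq_square)
  next
    case (3 n)
    show ?case
    proof
      let ?a = "cheb_numerator (Suc n)" and ?b = "cheb_numerator n"
      assume "?p dvd (cheb_numerator (Suc (Suc n)))\<^sup>2"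
      moreover have "(cheb_numerator (Suc (Suc n)))\<^sup>2
          = 4 * (?X * (?X * ?a\<^sup>2)) + ?p * (?p * ?b * (?p\<^sup>2 * ?b - 4 * ?X * ?a))"
      proof -
        have *: "(2 * x * a - p\<^sup>2 * b)\<^sup>2 = 4 * (x * (x * a\<^sup>2)) + p * (p * b * (p\<^sup>2 * b - 4 * x * a))"
          for x p a b :: "rat poly" by algebra
        have "[:0,2:] = 2 * ?X" by (simp add: numeral_poly)
        then show ?thesis by (simp only: cheb_numerator.simps *)
      qed
      ultimately have "?p dvd 4 * (?X * (?X * ?a\<^sup>2))"
        by (metis dvd_add_left_iff dvd_triv_left)
      then have "?p dvd smult (1 / 4) (4 * (?X * (?X * ?a\<^sup>2)))" by (rule dvd_smult)
      also have "smult (1 / 4) (4 * R) = R" for R :: "rat poly" by (simp add: numeral_poly)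
      finally have "?p dvd ?X * (?X * ?a\<^sup>2)" .
      with X 3(1) show False by blast
    qed
  qed
qed

lemma a_cheb_nonzero: "a_cheb n \<noteq> 0"
  using cheb_numerator_not_dvd[of n] by (auto simp: a_cheb_Fract Zero_fract_def eq_fract)

text \<open>The power of X^2 + 1 in the denominator of a_n^2 is exactly 2 n: for i < j,
  cross-multiplication would make X^2 + 1 divide the square of the j-th numerator.\<close>

lemma a_cheb_square_inj:
  assumes "(a_cheb i)\<^sup>2 = (a_cheb j)\<^sup>2"
  shows "i = j"
proof -
  have "\<not> i < j" if "(a_cheb i)\<^sup>2 = (a_cheb j)\<^sup>2" for i j
  proof
    assume "i < j"
    let ?p = "[:1, 0, 1:] :: rat poly"
    have p: "?p \<noteq> 0" by simp
    obtain d where d: "j = i + Suc d" using \<open>i < j\<close> less_imp_Suc_add by auto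
    have "(cheb_numerator i)\<^sup>2 * (?p ^ j)\<^sup>2 = (cheb_numerator j)\<^sup>2 * (?p ^ i)\<^sup>2"
      using that p by (simp add: a_cheb_Fract Fract_power eq_fract del: mult_pCons_left mult_pCons_right)
    then have "(?p ^ i)\<^sup>2 * (cheb_numerator j)\<^sup>2 = (?p ^ i)\<^sup>2 * (?p * (?p ^ d * ?p ^ Suc d * (cheb_numerator i)\<^sup>2))"
      unfolding d by (simp add: power_add power2_eq_square algebra_simps del: mult_pCons_left mult_pCons_right)
    then have "(cheb_numerator j)\<^sup>2 = ?p * (?p ^ d * ?p ^ Suc d * (cheb_numerator i)\<^sup>2)"
      using p by (simp del: mult_pCons_left mult_pCons_right)
    then show False using cheb_numerator_not_dvd[of j] by (metis dvd_triv_left)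
  qed
  from this[of i j] this[of j i] assms show ?thesis by (metis linorder_neqE_nat)
qed

text \<open>With cos theta = 1 / [2] this is cos (2 n theta); twice it will be the trace of
  \<open>omega ^ n\<close>.\<close>

definition cos2 :: "nat \<Rightarrow> K" where
  "cos2 n = 2 * (a_cheb n)\<^sup>2 - 1"

lemma cos2_0 [simp]: "cos2 0 = 1"
  by (simp add: cos2_def)

lemma cos2_Suc_Suc: "cos2 (Suc (Suc n)) = 2 * cos2 1 * cos2 (Suc n) - cos2 n"
proof -
  let ?x = "1 / two"
  \<comment> \<open>A quadratic form in consecutive values that the recurrence conserves; its value
    is sin^2 theta.\<close>
  have inv: "(a_cheb (Suc n))\<^sup>2 + (a_cheb n)\<^sup>2 - 2 * ?x * a_cheb (Suc n) * a_cheb n = 1 - ?x\<^sup>2" for n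
  proof (induction n)
    case 0 show ?case by (simp add: a_cheb_1 power2_eq_square)
  next
    case (Suc n)
    have *: "(2 * x * b - a)\<^sup>2 + b\<^sup>2 - 2 * x * (2 * x * b - a) * b = b\<^sup>2 + a\<^sup>2 - 2 * x * b * a" for a b x :: K
      by algebra
    show ?case unfolding a_cheb_Suc_Suc * by (rule Suc)
  qed
  have *: "2 * (2 * x * b - a)\<^sup>2 - 1 = 2 * (2 * x\<^sup>2 - 1) * (2 * b\<^sup>2 - 1) - (2 * a\<^sup>2 - 1)"
    if "b\<^sup>2 + a\<^sup>2 - 2 * x * b * a = 1 - x\<^sup>2" for a b x :: K
    using that by algebra
  show ?thesis
    unfolding cos2_def a_cheb_Suc_Suc One_nat_def a_cheb_1 by (rule *[OF inv])
qed

text \<open>The values 1 and -1 would mean a_n^2 = a_0^2 and a_n = 0. Hence \<open>omega ^ n\<close>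
  will have a nonzero second coordinate.\<close>

lemma cos2_square_ne_1: "n \<ge> 1 \<Longrightarrow> (cos2 n)\<^sup>2 \<noteq> 1"
proof
  assume n: "n \<ge> 1" and "(cos2 n)\<^sup>2 = 1"
  then have "(a_cheb n)\<^sup>2 = 0 \<or> (a_cheb n)\<^sup>2 = (a_cheb 0)\<^sup>2"
    unfolding cos2_def power2_eq_1_iff by auto
  then show False
    using n a_cheb_nonzero[of n] a_cheb_square_inj[of n 0] by (metis not_one_le_zero zero_eq_power2)
qed

section \<open>The quadratic extension\<close>

text \<open>The discriminant is that of \<open>X\<^sup>2 - 2 cos2 1 X + 1\<close>, whose roots are the eigenvalues of
  \<open>R\<^sub>1 R\<^sub>2\<close> on the two-dimensional representation of the Hecke algebra.\<close>

definition disc :: K where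
  "disc = (cos2 1)\<^sup>2 - 1"

lemma disc_nonzero: "disc \<noteq> 0"
  using cos2_square_ne_1[of 1] by (simp add: disc_def)

text \<open>\<open>Quad a b\<close> stands for a + b sqrt \<open>disc\<close>. A ring structure
  suffices: the inverses that occur are conjugates of powers of \<open>omega\<close>.\<close>

datatype quad = Quad (qre: K) (qim: K)

instantiation quad :: comm_ring_1
begin

definition "0 = Quad 0 0"
definition "1 = Quad 1 0"
definition "a + b = Quad (qre a + qre b) (qim a + qim b)"
definition "- a = Quad (- qre a) (- qim a)"
definition "a - b = Quad (qre a - qre b) (qim a - qim b)" for a b :: quad
definition "a * b = Quad (qre a * qre b + disc * (qim a * qim b)) (qre a * qim b + qim a * qre b)"

instance
  by standard (auto simp: zero_quad_def one_quad_def plus_quad_def uminus_quad_def minus_quad_def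
      times_quad_def algebra_simps)

end

lemma quad_sel [simp]:
  "qre 0 = 0" "qim 0 = 0" "qre 1 = 1" "qim 1 = 0"
  "qre (a + b) = qre a + qre b" "qim (a + b) = qim a + qim b"
  "qre (- a) = - qre a" "qim (- a) = - qim a"
  "qre (a - b) = qre a - qre b" "qim (a - b) = qim a - qim b"
  "qre (a * b) = qre a * qre b + disc * (qim a * qim b)" "qim (a * b) = qre a * qim b + qim a * qre b"
  by (simp_all add: zero_quad_def one_quad_def plus_quad_def uminus_quad_def minus_quad_def
      times_quad_def)

definition quad_of :: "K \<Rightarrow> quad" where
  "quad_of a = Quad a 0"

definition qscale :: "K \<Rightarrow> quad \<Rightarrow> quad" where
  "qscale c l = quad_of c * l"

definition qconj :: "quad \<Rightarrow> quad" where
  "qconj l = Quad (qre l) (- qim l)"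

text \<open>The eigenvalue w: formally exp (2 i theta), with trace \<open>2 * cos2 1\<close> and
  norm 1.\<close>

definition omega :: quad where
  "omega = Quad (cos2 1) 1"

lemma quad_of_sel [simp]: "qre (quad_of a) = a" "qim (quad_of a) = 0"
  by (simp_all add: quad_of_def)

lemma quad_of_hom:
  "quad_of 0 = 0" "quad_of 1 = 1" "quad_of (a + b) = quad_of a + quad_of b"
  "quad_of (a - b) = quad_of a - quad_of b" "quad_of (a * b) = quad_of a * quad_of b"
  by (simp_all add: quad.expand)

lemma quad_of_prod: "quad_of (\<Prod>x\<in>A. f x) = (\<Prod>x\<in>A. quad_of (f x))"
  by (induction A rule: infinite_finite_induct) (simp_all add: quad_of_hom)

lemma quad_of_inject: "quad_of a = quad_of b \<longleftrightarrow> a = b"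
  by (simp add: quad_of_def)

lemma qconj_sel [simp]: "qre (qconj l) = qre l" "qim (qconj l) = - qim l"
  by (simp_all add: qconj_def)

lemma qconj_hom:
  "qconj 1 = 1" "qconj (a + b) = qconj a + qconj b" "qconj (a - b) = qconj a - qconj b"
  "qconj (a * b) = qconj a * qconj b" "qconj (quad_of c) = quad_of c" "qconj (qconj a) = a"
  by (simp_all add: quad.expand)

lemma qconj_prod: "qconj (\<Prod>x\<in>A. f x) = (\<Prod>x\<in>A. qconj (f x))"
  by (induction A rule: infinite_finite_induct) (simp_all add: qconj_hom)

lemma qconj_power: "qconj (a ^ n) = qconj a ^ n"
  by (induction n) (simp_all add: qconj_hom)

lemma vector_space_qscale: "vector_space qscale"
  by unfold_locales (simp_all add: qscale_def quad_of_hom algebra_simps)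

lemma omega_sel [simp]: "qre omega = cos2 1" "qim omega = 1"
  by (simp_all add: omega_def)

lemma omega_norm: "omega * qconj omega = 1" "qconj omega * omega = 1"
  by (simp_all add: quad.expand disc_def power2_eq_square)

lemma omega_power_norm: "omega ^ n * qconj omega ^ n = 1" "qconj omega ^ n * omega ^ n = 1"
  by (simp_all add: omega_norm flip: power_mult_distrib)

lemma omega_square: "omega\<^sup>2 = quad_of (2 * cos2 1) * omega - 1"
  by (simp add: quad.expand power2_eq_square disc_def)

text \<open>De Moivre: the quadratic equation of \<open>omega\<close> gives both sides the same
  recurrence.\<close>

lemma qre_omega_power: "qre (omega ^ n) = cos2 n"
proof (induction n rule: cheb_numerator.induct)
  case (3 n)
  have "omega ^ Suc (Suc n) = omega ^ n * omega\<^sup>2" by (simp add: power2_eq_square mult_ac)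
  also have "\<dots> = quad_of (2 * cos2 1) * omega ^ Suc n - omega ^ n"
    by (simp add: omega_square algebra_simps)
  finally show ?case
    by (simp only: quad_sel quad_of_sel 3 cos2_Suc_Suc)
qed simp_all

text \<open>The trace of \<open>omega ^ n\<close> is \<open>2 * cos2 n\<close> and its norm is
  1.\<close>

lemma omega_power_root: "(omega ^ n)\<^sup>2 - quad_of (2 * cos2 n) * omega ^ n + 1 = 0"
proof -
  have "quad_of (2 * cos2 n) = omega ^ n + qconj omega ^ n"
    by (simp add: quad.expand qre_omega_power flip: qconj_power)
  then have "(omega ^ n)\<^sup>2 - quad_of (2 * cos2 n) * omega ^ n + 1 = 1 - qconj omega ^ n * omega ^ n"
    by (simp add: algebra_simps power2_eq_square)
  then show ?thesis by (simp add: omega_power_norm)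
qed

lemma qconj_omega_power_root:
  "(qconj omega ^ n)\<^sup>2 - quad_of (2 * cos2 n) * qconj omega ^ n + 1 = 0"
proof -
  have "qconj ((omega ^ n)\<^sup>2 - quad_of (2 * cos2 n) * omega ^ n + 1) = qconj 0"
    by (simp only: omega_power_root)
  then show ?thesis by (simp add: qconj_hom qconj_power) (simp add: quad.expand)
qed

lemma qim_omega_power: "(cos2 n)\<^sup>2 - disc * (qim (omega ^ n))\<^sup>2 = 1"
  using arg_cong[OF omega_power_norm(1)[of n], of qre]
  by (simp add: qre_omega_power power2_eq_square flip: qconj_power)

section \<open>Tensors\<close>

text \<open>A general ring of values is allowed because the factors will lie in
  \<open>quad\<close>.\<close>

lemma sum_tuples_prod_semiring:
  "(\<Sum>x\<in>tuples k. \<Prod>i<k. F i (x ! i)) = (\<Prod>i<k. \<Sum>v\<in>S3. (F i v :: 'a::comm_semiring_1))"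
proof (induction k arbitrary: F)
  case 0
  have "tuples 0 = {[]}" by (auto simp: tuples_def)
  then show ?case by simp
next
  case (Suc k)
  have "(\<Sum>x\<in>tuples (Suc k). \<Prod>i<Suc k. F i (x ! i)) =
        (\<Sum>(v, x)\<in>S3 \<times> tuples k. \<Prod>i<Suc k. F i ((v # x) ! i))"
    unfolding tuples_Suc by (subst sum.reindex) (auto simp: inj_on_def case_prod_beta)
  also have "\<dots> = (\<Sum>v\<in>S3. F 0 v) * (\<Sum>x\<in>tuples k. \<Prod>i<k. F (Suc i) (x ! i))"
    unfolding prod.lessThan_Suc_shift
    by (simp add: sum.cartesian_product sum_product)
  finally show ?case
    using Suc.IH[of "\<lambda>i. F (Suc i)"] by (simp add: prod.lessThan_Suc_shift del: prod.lessThan_Suc)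
qed

text \<open>In the expansion of the two products, a sign vector contributes equal terms if it has
  evenly many minus signs and opposite terms otherwise. The odd sums are carried along because a
  leading minus sign exchanges the parities.\<close>

lemma sum_signs:
  fixes p q :: "nat \<Rightarrow> 'a::comm_ring_1"
  shows "2 * (\<Sum>a | length a = k \<and> even (count_list a False). \<Prod>i<k. if a ! i then p i else q i)
    = (\<Prod>i<k. p i + q i) + (\<Prod>i<k. p i - q i)" (is "2 * ?E k p q = _")
    and "2 * (\<Sum>a | length a = k \<and> odd (count_list a False). \<Prod>i<k. if a ! i then p i else q i)
    = (\<Prod>i<k. p i + q i) - (\<Prod>i<k. p i - q i)" (is "2 * ?O k p q = _")
proof (induction k arbitrary: p q)
  case 0
  { case 1
    have "{a::bool list. length a = 0 \<and> even (count_list a False)} = {[]}" by auto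
    then show ?case by simp
  next
    case 2
    have e: "{a::bool list. length a = 0 \<and> odd (count_list a False)} = {}" by auto
    show ?case unfolding e by simp }
next
  case (Suc k)
  have fin: "finite {a. length a = n \<and> R a}" for n and R :: "bool list \<Rightarrow> bool"
    by (rule finite_subset[OF _ finite_lists_length_eq[of "UNIV :: bool set" n]]) auto
  have split: "(\<Sum>a | length a = Suc k \<and> R (count_list a False). \<Prod>i<Suc k. if a ! i then p i else q i)
    = p 0 * (\<Sum>a | length a = k \<and> R (count_list a False). \<Prod>i<k. if a ! i then p (Suc i) else q (Suc i))
    + q 0 * (\<Sum>a | length a = k \<and> R (Suc (count_list a False)). \<Prod>i<k. if a ! i then p (Suc i) else q (Suc i))"
    for R :: "nat \<Rightarrow> bool" and p q :: "nat \<Rightarrow> 'a"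
  proof -
    have "{a. length a = Suc k \<and> R (count_list a False)}
      = (#) True ` {a. length a = k \<and> R (count_list a False)}
      \<union> (#) False ` {a. length a = k \<and> R (Suc (count_list a False))}"
      (is "?L = ?R")
    proof (rule set_eqI)
      fix a show "a \<in> ?L \<longleftrightarrow> a \<in> ?R"
        by (cases a; cases "hd a") (simp_all add: image_iff)
    qed
    moreover have "(#) True ` A \<inter> (#) False ` B = {}" for A B by auto
    ultimately show ?thesis
      by (simp add: sum.union_disjoint fin sum.reindex prod.lessThan_Suc_shift sum_distrib_left
          del: prod.lessThan_Suc)
  qed
  have E: "?E (Suc k) p q = p 0 * ?E k (\<lambda>i. p (Suc i)) (\<lambda>i. q (Suc i)) + q 0 * ?O k (\<lambda>i. p (Suc i)) (\<lambda>i. q (Suc i))" for p q :: "nat \<Rightarrow> 'a"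
    by (rule split[where R = even, unfolded even_Suc])
  have O: "?O (Suc k) p q = p 0 * ?O k (\<lambda>i. p (Suc i)) (\<lambda>i. q (Suc i)) + q 0 * ?E k (\<lambda>i. p (Suc i)) (\<lambda>i. q (Suc i))" for p q :: "nat \<Rightarrow> 'a"
    by (rule split[where R = odd, unfolded even_Suc not_not])
  { case 1
    show ?case
      unfolding E distrib_left mult.left_commute[of 2] Suc.IH
      by (simp add: prod.lessThan_Suc_shift algebra_simps del: prod.lessThan_Suc)
  next
    case 2
    show ?case
      unfolding O distrib_left mult.left_commute[of 2] Suc.IH
      by (simp add: prod.lessThan_Suc_shift algebra_simps del: prod.lessThan_Suc) }
qed

text \<open>The involution R_i in the basis T_w: it is 1 where T_s = u and -1 where T_s =
  -1/u.\<close>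

definition refl_H :: "nat \<Rightarrow> hecke" where
  "refl_H i = (\<lambda>x. 2 / two * T (simple i) x + (inverse u - u) / two * T id x)"

definition refl_tensor :: "nat \<Rightarrow> nat \<Rightarrow> tensor" where
  "refl_tensor k i = pure (replicate k (refl_H i))"

lemma sum_tensor_apply: "(\<Sum>a\<in>A. f a) x = (\<Sum>a\<in>A. (f a :: tensor) x)"
  by (induction A rule: infinite_finite_induct) auto

text \<open>This is \<open>sum_signs\<close> with C' + C = [2] R and C' - C = [2].\<close>

lemma P_eq_refl_tensor: "P k i = smul (two ^ k / 2) (refl_tensor k i + tone k)"
proof
  fix x
  show "P k i x = smul (two ^ k / 2) (refl_tensor k i + tone k) x"
  proof (cases "x \<in> tuples k")
    case True
    let ?p = "\<lambda>j. C_plus i (x ! j)" and ?q = "\<lambda>j. C_minus i (x ! j)"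
    have "P k i x = (\<Sum>a | length a = k \<and> even (count_list a False). \<Prod>j<k. if a ! j then ?p j else ?q j)"
      unfolding P_def sum_tensor_apply
      using True by (intro sum.cong refl) (auto simp: pure_def intro!: prod.cong)
    then have "2 * P k i x = (\<Prod>j<k. ?p j + ?q j) + (\<Prod>j<k. ?p j - ?q j)"
      by (simp only: sum_signs)
    also have "(\<Prod>j<k. ?p j + ?q j) = (\<Prod>j<k. two * refl_H i (x ! j))"
      by (intro prod.cong refl) (simp add: C_plus_def C_minus_def refl_H_def field_simps)
    also have "(\<Prod>j<k. ?p j - ?q j) = (\<Prod>j<k. two * T id (x ! j))"
      by (intro prod.cong refl) (simp add: C_plus_def C_minus_def two_def algebra_simps)
    finally show ?thesis
      using True by (simp add: smul_def refl_tensor_def tone_def pure_def prod.distrib field_simps)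
  next
    case False
    then have 0: "pure hs x = 0" if "length hs = k" for hs
      using that by (simp add: pure_def)
    have "P k i x = 0"
      unfolding P_def sum_tensor_apply by (intro sum.neutral) (simp add: 0)
    then show ?thesis by (simp add: smul_def refl_tensor_def tone_def 0)
  qed
qed

section \<open>The algebra generated by the elements \<open>P\<^sub>i\<close>\<close>

declare plus_fun_apply [simp del] zero_fun_apply [simp del] minus_apply [simp del]

lemmas tensor_apply = plus_fun_apply zero_fun_apply minus_apply smul_def

lemma tmult_linear:
  "tmult k (f + g) h = tmult k f h + tmult k g h" "tmult k h (f + g) = tmult k h f + tmult k h g"
  "tmult k (smul c f) g = smul c (tmult k f g)" "tmult k f (smul c g) = smul c (tmult k f g)"
  by (rule ext; simp add: tmult_def tensor_apply algebra_simps sum.distrib sum_distrib_left)+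

lemma tmult_zero [simp]: "tmult k 0 h = 0" "tmult k h 0 = 0"
  by (rule ext; simp add: tmult_def tensor_apply)+

lemma check_H_subset: "check_H k \<subseteq> K_check_H k"
  unfolding K_check_H_def by (rule tensor.span_superset)

lemma K_check_H_closed:
  "tone k \<in> K_check_H k" "i \<in> {1, 2} \<Longrightarrow> P k i \<in> K_check_H k"
  "f \<in> K_check_H k \<Longrightarrow> g \<in> K_check_H k \<Longrightarrow> f + g \<in> K_check_H k"
  "f \<in> K_check_H k \<Longrightarrow> g \<in> K_check_H k \<Longrightarrow> f - g \<in> K_check_H k"
  "f \<in> K_check_H k \<Longrightarrow> smul c f \<in> K_check_H k"
  using check_H_subset[of k] check_H.one[of k] check_H.gen[of i k]
  by (auto simp: K_check_H_def intro: tensor.span_add tensor.span_scale tensor.span_diff)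

lemma K_check_H_tmult:
  assumes "f \<in> K_check_H k" "g \<in> K_check_H k"
  shows "tmult k f g \<in> K_check_H k"
proof -
  have 1: "tmult k f g \<in> K_check_H k" if f: "f \<in> check_H k" for f
    using assms(2) unfolding K_check_H_def
  proof (induction rule: tensor.span_induct_alt)
    case base show ?case by (simp add: tensor.span_zero)
  next
    case (step c x y)
    then show ?case
      using check_H.mult[OF f step(1)]
      by (simp add: tmult_linear tensor.span_add tensor.span_scale tensor.span_base)
  qed
  show ?thesis
    using assms(1) unfolding K_check_H_def
  proof (induction rule: tensor.span_induct_alt)
    case base show ?case by (simp add: tensor.span_zero)
  next
    case (step c x y)
    then show ?case
      using 1[OF step(1)] unfolding K_check_H_def
      by (simp add: tmult_linear tensor.span_add tensor.span_scale)
  qed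
qed

text \<open>Allowing all scalars of K in the induction removes the Laurent coefficients from all
  later arguments.\<close>

lemma K_check_H_induct [consumes 1, case_names one gen add smul mult]:
  assumes "h \<in> K_check_H k"
    and one: "Q (tone k)"
    and gen: "\<And>i. i \<in> {1, 2} \<Longrightarrow> Q (P k i)"
    and add: "\<And>f g. f \<in> K_check_H k \<Longrightarrow> g \<in> K_check_H k \<Longrightarrow> Q f \<Longrightarrow> Q g \<Longrightarrow> Q (f + g)"
    and smul: "\<And>c f. f \<in> K_check_H k \<Longrightarrow> Q f \<Longrightarrow> Q (smul c f)"
    and mult: "\<And>f g. f \<in> K_check_H k \<Longrightarrow> g \<in> K_check_H k \<Longrightarrow> Q f \<Longrightarrow> Q g \<Longrightarrow> Q (tmult k f g)"
  shows "Q h"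
proof -
  have *: "Q f" if "f \<in> check_H k" for f
    using that
  proof induction
    case one show ?case by (rule assms(2))
  next
    case (gen i) then show ?case by (rule assms(3))
  next
    case (add f g) then show ?case using check_H_subset by (intro assms(4)) auto
  next
    case (smul c f) then show ?case using check_H_subset by (intro assms(5)) auto
  next
    case (mult f g) then show ?case using check_H_subset by (intro assms(6)) auto
  qed
  \<comment> \<open>The zero tensor, from which the span is built up, arises as 0 times the
    unit.\<close>
  have Q0: "Q 0"
    using smul[OF K_check_H_closed(1) one, of 0] by (simp add: smul_def flip: zero_fun_def)
  have "Q h \<and> h \<in> K_check_H k"
    using assms(1) unfolding K_check_H_def
  proof (induction rule: tensor.span_induct_alt)
    case base show ?case by (simp add: Q0 tensor.span_zero)
  next
    case (step c x y)
    have x: "x \<in> K_check_H k" using step(1) check_H_subset by blast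
    have "smul c x \<in> K_check_H k" by (rule K_check_H_closed(5)[OF x])
    moreover have "y \<in> K_check_H k" using step(2) by (simp add: K_check_H_def)
    ultimately
    show ?case
      using add[of "smul c x" y] smul[OF x *[OF step(1)]] step(2) K_check_H_closed(3)
      unfolding K_check_H_def by blast
  qed
  then show ?thesis by blast
qed

lemma pure_replicate_mult:
  "tmult k (pure (replicate k g)) (pure (replicate k h)) = pure (replicate k (hmult g h))"
  by (simp add: tmult_pure zip_replicate)

lemma refl_in_K_check_H: "i \<in> {1, 2} \<Longrightarrow> refl_tensor k i \<in> K_check_H k"
proof -
  assume i: "i \<in> {1, 2}"
  have "refl_tensor k i = smul (2 / two ^ k) (P k i) - tone k"
    by (rule ext) (simp add: P_eq_refl_tensor tensor_apply field_simps)
  then show ?thesis using i by (auto intro!: K_check_H_closed)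
qed

section \<open>The span of the pure tensors\<close>

definition pures :: "nat \<Rightarrow> tensor set" where
  "pures k = tensor.span {pure hs | hs. length hs = k}"

lemma pure_in_pures: "length hs = k \<Longrightarrow> pure hs \<in> pures k"
  unfolding pures_def by (rule tensor.span_base) blast

lemma pures_induct [consumes 1, case_names zero add]:
  assumes "f \<in> pures k" "Q 0"
    and "\<And>c hs f. length hs = k \<Longrightarrow> f \<in> pures k \<Longrightarrow> Q f \<Longrightarrow> Q (smul c (pure hs) + f)"
  shows "Q f"
proof -
  have "Q f \<and> f \<in> pures k"
    using assms(1) unfolding pures_def
  proof (induction rule: tensor.span_induct_alt)
    case base show ?case by (simp add: assms(2) tensor.span_zero)
  next
    case (step c x y)
    then obtain hs where hs: "x = pure hs" "length hs = k" by auto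
    have "smul c x + y \<in> tensor.span {pure hs | hs. length hs = k}"
      by (rule tensor.span_add[OF tensor.span_scale[OF tensor.span_base[OF step(1)]] conjunct2[OF step(2)]])
    with assms(3)[of hs y c] hs step show ?case by (simp add: pures_def)
  qed
  then show ?thesis by blast
qed

text \<open>Multiplicativity is known explicitly only on pure tensors, by \<open>tmult_pure\<close>;
  bilinearity carries it to their span.\<close>

lemma pures_bilinear_induct:
  assumes "f \<in> pures k" "g \<in> pures k"
    and zero: "\<And>f. Q 0 f" "\<And>f. Q f 0"
    and pure: "\<And>gs hs. length gs = k \<Longrightarrow> length hs = k \<Longrightarrow> Q (pure gs) (pure hs)"
    and add: "\<And>c f g h. Q f h \<Longrightarrow> Q g h \<Longrightarrow> Q (smul c f + g) h"
      "\<And>c f g h. Q h f \<Longrightarrow> Q h g \<Longrightarrow> Q h (smul c f + g)"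
  shows "Q f g"
proof -
  have "Q (pure hs) g" if "length hs = k" for hs
    using assms(2) by (induction rule: pures_induct) (use that in \<open>auto intro: zero pure add\<close>)
  with assms(1) show ?thesis
    by (induction rule: pures_induct) (auto intro: zero add)
qed

lemma K_check_H_subset_pures: "K_check_H k \<subseteq> pures k"
proof
  fix h assume "h \<in> K_check_H k"
  then show "h \<in> pures k"
  proof (induction rule: K_check_H_induct)
    case one show ?case unfolding tone_def by (rule pure_in_pures) simp
  next
    case (gen i)
    show ?case unfolding P_def pures_def
      by (intro tensor.span_sum tensor.span_base) auto
  next
    case (mult f g)
    from mult(3,4) show ?case
    proof (rule pures_bilinear_induct)
      show "tmult k (pure gs) (pure hs) \<in> pures k" if "length gs = k" "length hs = k" for gs hs
        using that by (auto simp: tmult_pure intro: pure_in_pures)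
      show "tmult k 0 f \<in> pures k" "tmult k f 0 \<in> pures k" for f
        by (simp_all add: pures_def tensor.span_zero)
    qed (simp_all add: tmult_linear pures_def tensor.span_add tensor.span_scale)
  qed (simp_all add: pures_def tensor.span_add tensor.span_scale)
qed

section \<open>Contraction of leading tensor factors by the trivial character\<close>

lemma eps_contract_linear:
  "eps_contract k j (f + g) = eps_contract k j f + eps_contract k j g"
  "eps_contract k j (smul c f) = smul c (eps_contract k j f)"
  by (rule ext; simp add: eps_contract_def tensor_apply algebra_simps sum.distrib sum_distrib_left)+

text \<open>The trivial character is multiplicative on the Hecke algebra, so applying it to the
  first k - j factors respects products.\<close>

lemma eps_contract_tmult:
  assumes "f \<in> pures k" "g \<in> pures k" "j \<le> k"
  shows "eps_contract k j (tmult k f g) = tmult j (eps_contract k j f) (eps_contract k j g)"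
  using assms(1,2)
proof (rule pures_bilinear_induct)
  have 0: "eps_contract k j 0 = 0"
    by (rule ext; simp add: eps_contract_def tensor_apply)
  show "eps_contract k j (tmult k 0 f) = tmult j (eps_contract k j 0) (eps_contract k j f)"
    "eps_contract k j (tmult k f 0) = tmult j (eps_contract k j f) (eps_contract k j 0)" for f
    by (simp_all add: 0)
  fix gs hs :: "hecke list"
  assume len: "length gs = k" "length hs = k"
  let ?t = "take (k - j)" and ?d = "drop (k - j)"
  have split: "pure as = pure (?t as @ ?d as)" "length (?t as) = k - j" "length (?d as) = j"
    if "length as = k" for as
    using that assms(3) by simp_all
  have "map2 hmult gs hs = map2 hmult (?t gs) (?t hs) @ map2 hmult (?d gs) (?d hs)"
    by (metis append_take_drop_id drop_map drop_zip take_map take_zip)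
  then have "eps_contract k j (tmult k (pure gs) (pure hs))
    = eps_contract k j (pure (map2 hmult (?t gs) (?t hs) @ map2 hmult (?d gs) (?d hs)))"
    using len by (simp add: tmult_pure)
  also have "\<dots> = smul (\<Prod>i<k - j. eps (?t gs ! i) * eps (?t hs ! i)) (pure (map2 hmult (?d gs) (?d hs)))"
    using len assms(3) by (subst eps_contract_pure) (simp_all add: eps_hmult)
  also have "\<dots> = tmult j (eps_contract k j (pure gs)) (eps_contract k j (pure hs))"
    using len assms(3) split
    by (simp only: split(1) eps_contract_pure)
      (simp add: tmult_linear tmult_pure prod.distrib mult.commute)
  finally show "eps_contract k j (tmult k (pure gs) (pure hs))
    = tmult j (eps_contract k j (pure gs)) (eps_contract k j (pure hs))" .
qed (simp_all add: tmult_linear eps_contract_linear)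

lemma eps_T_id: "eps (T id) = 1"
  by (simp add: eps_def T_def if_distrib[of "\<lambda>c. c * _"] finite_S3 S3_mem eps_T_def len_values cong: if_cong)

lemma eps_contract_tone: "j \<le> k \<Longrightarrow> eps_contract k j (tone k) = tone j"
  using eps_contract_pure[of "replicate (k - j) (T id)" k j "replicate j (T id)"]
  by (simp add: tone_def eps_T_id replicate_add[symmetric])

text \<open>Generators go to multiples of generators, so \<open>eps_tensor\<close> evaluates a
  representation only inside its algebra.\<close>

lemma eps_contract_in_K_check_H:
  assumes "h \<in> K_check_H k" "j \<le> k"
  shows "eps_contract k j h \<in> K_check_H j"
  using assms(1)
proof (induction rule: K_check_H_induct)
  case (mult f g)
  then have "f \<in> pures k" "g \<in> pures k" using K_check_H_subset_pures by blast+
  then show ?case using mult assms(2) by (simp add: eps_contract_tmult K_check_H_tmult)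
qed (use assms(2) in \<open>auto simp: eps_contract_tone eps_contract_P eps_contract_linear K_check_H_closed\<close>)

declare One_nat_def [simp del]

section \<open>The action on the quadratic extension\<close>

text \<open>The factor \<open>qconj omega\<close> makes R_1 R_2 the multiplication by
  \<open>omega\<close>; having norm 1, it leaves R_2 an involution.\<close>

definition refl_quad :: "nat \<Rightarrow> quad \<Rightarrow> quad" where
  "refl_quad i l = (if i = 1 then qconj l else qconj omega * qconj l)"

text \<open>The formula of \<open>refl_H\<close>, solved for T_s.\<close>

definition T_quad :: "nat \<Rightarrow> quad \<Rightarrow> quad" where
  "T_quad i l = qscale (two / 2) (refl_quad i l) + qscale ((u - inverse u) / 2) l"

definition Tw_quad :: "perm3 \<Rightarrow> quad \<Rightarrow> quad" where
  "Tw_quad w = foldr T_quad (reduced_word w)"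

definition act :: "hecke \<Rightarrow> quad \<Rightarrow> quad" where
  "act h l = (\<Sum>w\<in>S3. qscale (h w) (Tw_quad w l))"

lemma qscale_linear [simp]:
  "qscale c (a + b) = qscale c a + qscale c b" "qscale c (qscale d a) = qscale (c * d) a"
  "qscale c (a - b) = qscale c a - qscale c b"
  "qscale (c + d) a = qscale c a + qscale d a" "qscale (c - d) a = qscale c a - qscale d a"
  "qscale 1 a = a" "qscale 0 a = 0" "qscale c 0 = 0"
  "qscale c a * b = qscale c (a * b)" "a * qscale c b = qscale c (a * b)"
  by (simp_all add: qscale_def quad_of_hom algebra_simps)

lemma qscale_sum: "qscale c (\<Sum>x\<in>A. f x) = (\<Sum>x\<in>A. qscale c (f x))"
  by (simp add: qscale_def sum_distrib_left)

lemma refl_quad_linear: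
  "refl_quad i (a + b) = refl_quad i a + refl_quad i b" "refl_quad i (qscale c a) = qscale c (refl_quad i a)"
  by (simp_all add: refl_quad_def qscale_def qconj_hom algebra_simps)

lemma refl_quad_invol [simp]: "refl_quad i (refl_quad i l) = l"
  by (simp add: refl_quad_def qconj_hom omega_norm flip: mult.assoc)

lemma omega_trace: "quad_of (2 * cos2 1) = omega + qconj omega"
  by (simp add: quad.expand)

text \<open>Every term is a polynomial in w and v = 1/w times \<open>qconj l\<close>; the identity
  is w - v^2 = (w + v + 1) (1 - v).\<close>

lemma refl_quad_braid:
  "refl_quad 1 (refl_quad 2 (refl_quad 1 l)) - refl_quad 2 (refl_quad 1 (refl_quad 2 l))
    = qscale (2 * cos2 1 + 1) (refl_quad 1 l - refl_quad 2 l)"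
proof -
  have "(w + v + 1) * ((1 - v) * x) = (w - v * v) * x + (1 - w * v) * x" for w v x :: quad
    by (simp add: algebra_simps)
  then have "(w - v * v) * x = (w + v + 1) * ((1 - v) * x)" if "w * v = 1" for w v x :: quad
    using that by simp
  note * = this[OF omega_norm(1)]
  have 1: "refl_quad 1 (refl_quad 2 (refl_quad 1 l)) = omega * qconj l"
    "refl_quad 2 (refl_quad 1 (refl_quad 2 l)) = qconj omega * qconj omega * qconj l"
    "refl_quad 1 l - refl_quad 2 l = (1 - qconj omega) * qconj l"
    by (simp_all add: refl_quad_def qconj_hom algebra_simps)
  show ?thesis
    unfolding 1 qscale_def quad_of_hom(2,3) omega_trace *[symmetric] by (simp only: left_diff_distrib)
qed

lemma T_quad_linear:
  "T_quad i (a + b) = T_quad i a + T_quad i b" "T_quad i (qscale c a) = qscale c (T_quad i a)"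
  by (simp_all add: T_quad_def refl_quad_linear mult.commute del: qscale_linear(4,5))

lemma two_square: "two\<^sup>2 = (u - inverse u)\<^sup>2 + 4"
  using u_nonzero by (simp add: two_def power2_eq_square field_simps)

text \<open>This value of \<open>cos2 1\<close> is the one for which the cubic relation between the
  involutions becomes the braid relation of the T_s.\<close>

lemma cos2_1: "(2 * cos2 1 + 1) * two\<^sup>2 = - ((u - inverse u)\<^sup>2)"
proof -
  have "(2 * cos2 1 + 1) * two\<^sup>2 = 4 - two\<^sup>2"
    by (simp add: cos2_def a_cheb_1 One_nat_def field_simps)
  then show ?thesis using two_square by simp
qed

lemma T_quad_square: "T_quad i (T_quad i l) = l + qscale (u - inverse u) (T_quad i l)"
proof -
  have *: "qscale ((two / 2) * (two / 2)) l = l + qscale ((u - inverse u) / 2 * ((u - inverse u) / 2)) l"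
  proof -
    have "(two / 2) * (two / 2) = 1 + (u - inverse u) / 2 * ((u - inverse u) / 2)"
      using two_square by (simp add: power2_eq_square field_simps)
    then show ?thesis by (simp only: qscale_linear(4,6))
  qed
  have **: "qscale ((u - inverse u) * c) a = qscale ((u - inverse u) / 2 * c) a + qscale ((u - inverse u) / 2 * c) a" for a c
    by (simp only: qscale_linear(4)[symmetric]) (simp add: mult.commute)
  show ?thesis
    unfolding T_quad_def refl_quad_linear refl_quad_invol qscale_linear(1,2) * **
    by (simp only: mult.commute add_ac)
qed

text \<open>With T = a R + b, the terms of degree two in R cancel, leaving a^3 (R_1 R_2 R_1 - R_2
  R_1 R_2) + a b^2 (R_1 - R_2), which vanishes by \<open>refl_quad_braid\<close> and
  \<open>cos2_1\<close>.\<close>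

lemma T_quad_braid: "T_quad 2 (T_quad 1 (T_quad 2 l)) = T_quad 1 (T_quad 2 (T_quad 1 l))"
proof -
  let ?a = "two / 2" and ?b = "(u - inverse u) / 2"
  have ab: "?a * (?a * (?a * (2 * cos2 1 + 1))) = - (?a * (?b * ?b))"
    using arg_cong[OF cos2_1, of "\<lambda>c. two * c / 8"] by (simp add: power2_eq_square field_simps)
  have "T_quad 1 (T_quad 2 (T_quad 1 l)) - T_quad 2 (T_quad 1 (T_quad 2 l))
    = qscale (?a * (?a * ?a)) (refl_quad 1 (refl_quad 2 (refl_quad 1 l)) - refl_quad 2 (refl_quad 1 (refl_quad 2 l)))
     + qscale (?a * (?b * ?b)) (refl_quad 1 l - refl_quad 2 l)"
    unfolding T_quad_def refl_quad_linear refl_quad_invol qscale_linear(1-3)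
    by (simp add: mult_ac del: qscale_linear(4,5))
  also have "\<dots> = qscale (?a * (?a * (?a * (2 * cos2 1 + 1))) + ?a * (?b * ?b)) (refl_quad 1 l - refl_quad 2 l)"
    by (simp only: refl_quad_braid qscale_linear(2) qscale_linear(4)[symmetric] mult.assoc)
  also have "\<dots> = 0" unfolding ab by simp
  finally show ?thesis by simp
qed

lemma Tw_quad_values:
  "Tw_quad id l = l" "Tw_quad s1 l = T_quad 1 l" "Tw_quad s2 l = T_quad 2 l"
  "Tw_quad w12 l = T_quad 1 (T_quad 2 l)" "Tw_quad w21 l = T_quad 2 (T_quad 1 l)"
  "Tw_quad w0 l = T_quad 1 (T_quad 2 (T_quad 1 l))"
proof -
  \<comment> \<open>The choice in \<open>reduced_word\<close> may give either word of length three;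
    the braid relation makes them act alike.\<close>
  show "Tw_quad w0 l = T_quad 1 (T_quad 2 (T_quad 1 l))"
    using reduced_word_values(6) by (rule disjE) (simp_all only: Tw_quad_def foldr.simps comp_apply id_apply T_quad_braid)
qed (simp_all add: Tw_quad_def reduced_word_values)

lemma Tw_quad_linear:
  "Tw_quad w (a + b) = Tw_quad w a + Tw_quad w b" "Tw_quad w (qscale c a) = qscale c (Tw_quad w a)"
proof -
  have "foldr T_quad ws (a + b) = foldr T_quad ws a + foldr T_quad ws b"
    "foldr T_quad ws (qscale c a) = qscale c (foldr T_quad ws a)" for ws
    by (induction ws) (simp_all add: T_quad_linear)
  then show "Tw_quad w (a + b) = Tw_quad w a + Tw_quad w b" "Tw_quad w (qscale c a) = qscale c (Tw_quad w a)"
    by (simp_all add: Tw_quad_def)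
qed

lemma act_linear:
  "act h (a + b) = act h a + act h b" "act h (qscale c a) = qscale c (act h a)"
  by (simp_all add: act_def Tw_quad_linear sum.distrib qscale_sum mult.commute)

lemma act_linear_left: "act (\<lambda>x. c * g x + h x) l = qscale c (act g l) + act h l"
  by (simp add: act_def sum.distrib qscale_sum)

lemma act_zero: "act (\<lambda>_. 0) l = 0"
  by (simp add: act_def)

lemma act_T: "w \<in> S3 \<Longrightarrow> act (T w) l = Tw_quad w l"
  by (simp add: act_def T_def if_distrib[of "\<lambda>c. qscale c _"] finite_S3 cong: if_cong)

lemma act_lmul: "i \<in> {1, 2} \<Longrightarrow> act (lmul i h) l = T_quad i (act h l)"
  unfolding act_def sum_S3
  by (elim insertE emptyE; hypsubst)
    (simp_all only: lmul_id lmul_values Tw_quad_values T_quad_linear T_quad_square T_quad_braid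
      qscale_linear(1,2,4), simp_all add: T_quad_square T_quad_braid[symmetric] mult_ac add_ac del: qscale_linear(5))

text \<open>Expanding the left factor turns the product into words in \<open>lmul\<close>, which
  \<open>act_lmul\<close> translates letter by letter.\<close>

lemma act_hmult: "act (hmult g h) l = act g (act h l)"
proof -
  \<comment> \<open>The nested shape ending in 0 lets \<open>act_linear_left\<close> split off one
    term at a time.\<close>
  have "hmult g h = (\<lambda>x. g id * h x + (g s1 * lmul 1 h x + (g s2 * lmul 2 h x
    + (g w12 * lmul 1 (lmul 2 h) x + (g w21 * lmul 2 (lmul 1 h) x + (g w0 * lmul 1 (lmul 2 (lmul 1 h)) x + 0))))))"
    by (rule ext) (simp only: hmult_eq add.assoc add_0_right)
  then show ?thesis
    by (simp only: act_linear_left act_zero act_def[of g] sum_S3 Tw_quad_values)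
      (simp add: act_lmul add.assoc)
qed

lemma act_refl_H: "i \<in> {1, 2} \<Longrightarrow> act (refl_H i) l = refl_quad i l"
proof -
  assume i: "i \<in> {1, 2}"
  have *: "act (\<lambda>x. d * T id x) l = qscale d l" for d
    using act_linear_left[of d "T id" "\<lambda>_. 0" l] by (simp add: act_zero act_T Tw_quad_values)
  have "act (refl_H i) l = qscale (2 / two) (act (T (simple i)) l) + qscale ((inverse u - u) / two) l"
    unfolding refl_H_def act_linear_left * ..
  also have "act (T (simple i)) l = T_quad i l"
    using i by (auto simp: act_T Tw_quad_values)
  finally have "act (refl_H i) l = refl_quad i l + qscale (2 / two * ((u - inverse u) / 2) + (inverse u - u) / two) l"
    by (simp add: T_quad_def del: qscale_linear(5))
  also have "2 / two * ((u - inverse u) / 2) + (inverse u - u) / two = 0" by (simp add: field_simps)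
  finally show ?thesis by simp
qed

lemma act_T_id: "act (T id) l = l"
  by (simp add: act_T Tw_quad_values)

text \<open>The action on the pure tensor of the \<open>ls i\<close>, followed by the multiplication
  map to the quadratic extension; its tensor power is thus never constructed.\<close>

definition act_tensor :: "nat \<Rightarrow> tensor \<Rightarrow> (nat \<Rightarrow> quad) \<Rightarrow> quad" where
  "act_tensor k h ls = (\<Sum>x\<in>tuples k. qscale (h x) (\<Prod>i<k. Tw_quad (x ! i) (ls i)))"

lemma act_tensor_linear:
  "act_tensor k (f + g) ls = act_tensor k f ls + act_tensor k g ls"
  "act_tensor k (smul c f) ls = qscale c (act_tensor k f ls)"
  "act_tensor k 0 ls = 0"
  by (simp_all add: act_tensor_def tensor_apply sum.distrib qscale_sum)

lemma act_tensor_pure: "length hs = k \<Longrightarrow> act_tensor k (pure hs) ls = (\<Prod>i<k. act (hs ! i) (ls i))"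
  unfolding act_def
  by (simp only: sum_tuples_prod_semiring[where F = "\<lambda>i w. qscale ((hs ! i) w) (Tw_quad w (ls i))", symmetric])
    (simp add: act_tensor_def pure_def qscale_def quad_of_prod prod.distrib)

lemma act_tensor_tmult_pure:
  assumes "f \<in> pures k" "length hs = k"
  shows "act_tensor k (tmult k f (pure hs)) ls = act_tensor k f (\<lambda>i. act (hs ! i) (ls i))"
  using assms(1)
  by (induction rule: pures_induct)
    (simp_all add: tmult_linear act_tensor_linear tmult_pure act_tensor_pure act_hmult assms(2))

text \<open>On the algebra generated by the \<open>P\<^sub>i\<close>, the multiplication map from the tensor power of the
  quadratic extension to the extension intertwines \<open>act_tensor\<close> with \<open>rho\<close>.\<close>

definition rho :: "nat \<Rightarrow> tensor \<Rightarrow> quad \<Rightarrow> quad" where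
  "rho k h l = act_tensor k h (\<lambda>i. if i = 0 then l else 1)"

lemma rho_linear_left:
  "rho k (f + g) l = rho k f l + rho k g l" "rho k (smul c f) l = qscale c (rho k f l)"
  by (simp_all add: rho_def act_tensor_linear)

lemma rho_linear:
  assumes "k \<ge> 1"
  shows "rho k h (a + b) = rho k h a + rho k h b" "rho k h (qscale c a) = qscale c (rho k h a)"
  using assms
  by (cases k; simp add: rho_def act_tensor_def prod.lessThan_Suc_shift Tw_quad_linear algebra_simps
      sum.distrib qscale_sum del: prod.lessThan_Suc)+

lemma rho_zero: "k \<ge> 1 \<Longrightarrow> rho k h 0 = 0"
  using rho_linear(2)[of k h 0 0] by simp

lemma prod_single: "k \<ge> 1 \<Longrightarrow> (\<Prod>i<k. if i = (0::nat) then l else 1) = l"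
  by (simp add: prod.delta)

text \<open>Conjugation is multiplicative and each factor R_2 contributes one
  \<open>qconj omega\<close>, so the result depends only on the product of the
  \<open>ls i\<close>.\<close>

lemma rho_refl:
  assumes "k \<ge> 1"
  shows "act_tensor k (refl_tensor k 1) ls = qconj (\<Prod>i<k. ls i)" "rho k (refl_tensor k 1) l = qconj l"
    "act_tensor k (refl_tensor k 2) ls = qconj omega ^ k * qconj (\<Prod>i<k. ls i)" "rho k (refl_tensor k 2) l = qconj omega ^ k * qconj l"
proof -
  show *: "act_tensor k (refl_tensor k 1) ls = qconj (\<Prod>i<k. ls i)"
    "act_tensor k (refl_tensor k 2) ls = qconj omega ^ k * qconj (\<Prod>i<k. ls i)" for ls
    by (simp_all add: refl_tensor_def act_tensor_pure act_refl_H refl_quad_def qconj_prod prod.distrib)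
  show "rho k (refl_tensor k 1) l = qconj l" "rho k (refl_tensor k 2) l = qconj omega ^ k * qconj l"
    using assms by (simp_all add: rho_def * prod_single)
qed

lemma rho_tone:
  "act_tensor k (tone k) ls = (\<Prod>i<k. ls i)" "k \<ge> 1 \<Longrightarrow> rho k (tone k) l = l"
  by (simp_all add: rho_def tone_def act_tensor_pure act_T_id prod_single)

text \<open>The hypothesis on f says that its action descends along the multiplication map. A
  general tensor does not descend, so products can be treated only for such f.\<close>

lemma act_tensor_tmult:
  assumes "k \<ge> 1" "f \<in> pures k" "g \<in> pures k" and f: "\<And>ls. act_tensor k f ls = rho k f (\<Prod>i<k. ls i)"
  shows "act_tensor k (tmult k f g) ls = rho k f (act_tensor k g ls)"
  using assms(3)
  by (induction rule: pures_induct)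
    (simp_all add: tmult_linear act_tensor_linear act_tensor_tmult_pure assms(2) f rho_linear rho_zero
      act_tensor_pure assms(1))

text \<open>Generators descend by \<open>rho_refl\<close>, and \<open>act_tensor_tmult\<close>
  passes this on to products.\<close>

lemma act_tensor_K_check_H:
  assumes "k \<ge> 1" "h \<in> K_check_H k"
  shows "act_tensor k h ls = rho k h (\<Prod>i<k. ls i)"
  using assms(2)
proof (induction arbitrary: ls rule: K_check_H_induct)
  case (mult f g)
  then have "f \<in> pures k" "g \<in> pures k" using K_check_H_subset_pures by blast+
  note * = act_tensor_tmult[OF assms(1) this mult(3)]
  show ?case by (simp add: * mult(4) rho_def[of k "tmult k f g"] prod_single assms(1))
qed (use assms(1) in \<open>auto simp: rho_tone P_eq_refl_tensor rho_refl act_tensor_linear rho_linear_left\<close>)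

lemma rho_tmult:
  assumes "k \<ge> 1" "f \<in> K_check_H k" "g \<in> K_check_H k"
  shows "rho k (tmult k f g) l = rho k f (rho k g l)"
proof -
  have "f \<in> pures k" "g \<in> pures k" using assms K_check_H_subset_pures by blast+
  from act_tensor_tmult[OF assms(1) this act_tensor_K_check_H[OF assms(1,2)]]
  show ?thesis by (simp add: rho_def)
qed

lemma is_rep_rho: "k \<ge> 1 \<Longrightarrow> is_rep k qscale (rho k)"
  by (simp add: is_rep_def vector_space_qscale Vector_Spaces.linear_iff rho_linear rho_linear_left
      rho_tone rho_tmult)

section \<open>Representations\<close>

lemma is_repD:
  assumes "is_rep k sc \<rho>"
  shows "vector_space sc" "h \<in> K_check_H k \<Longrightarrow> \<rho> h (v + w) = \<rho> h v + \<rho> h w"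
    "h \<in> K_check_H k \<Longrightarrow> \<rho> h (sc c v) = sc c (\<rho> h v)" "\<rho> (tone k) v = v"
    "g \<in> K_check_H k \<Longrightarrow> h \<in> K_check_H k \<Longrightarrow> \<rho> (g + h) v = \<rho> g v + \<rho> h v"
    "g \<in> K_check_H k \<Longrightarrow> h \<in> K_check_H k \<Longrightarrow> \<rho> (tmult k g h) v = \<rho> g (\<rho> h v)"
    "h \<in> K_check_H k \<Longrightarrow> \<rho> (smul c h) v = sc c (\<rho> h v)"
  using assms by (auto simp: is_rep_def Vector_Spaces.linear_iff)

lemma is_rep_transport:
  assumes \<rho>: "is_rep k sc \<rho>" and \<phi>: "Vector_Spaces.linear sc' sc \<phi>" "bij \<phi>"
  shows "is_rep k sc' (\<lambda>h v. inv \<phi> (\<rho> h (\<phi> v)))"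
proof -
  have inv1: "inv \<phi> (\<phi> v) = v" and inv2: "\<phi> (inv \<phi> w) = w" for v w
    using \<phi>(2) by (simp_all add: bij_is_inj bij_is_surj surj_f_inv_f)
  have lin: "vector_space sc'" "\<phi> (v + w) = \<phi> v + \<phi> w" "\<phi> (sc' c v) = sc c (\<phi> v)" for v w c
    using \<phi>(1) by (simp_all add: Vector_Spaces.linear_iff)
  have "inv \<phi> (a + b) = inv \<phi> a + inv \<phi> b" "inv \<phi> (sc c a) = sc' c (inv \<phi> a)" for a b c
    by (metis inv1 inv2 lin(2)) (metis inv1 inv2 lin(3))
  then show ?thesis
    by (simp add: is_rep_def Vector_Spaces.linear_iff lin inv1 inv2 is_repD[OF \<rho>])
qed

lemma rep_intertwines:
  assumes "is_rep k sc \<rho>" "is_rep k sc' \<sigma>" "Vector_Spaces.linear sc sc' \<phi>"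
    and "\<And>i v. i \<in> {1, 2} \<Longrightarrow> \<phi> (\<rho> (P k i) v) = \<sigma> (P k i) (\<phi> v)"
    and "h \<in> K_check_H k"
  shows "\<phi> (\<rho> h v) = \<sigma> h (\<phi> v)"
  using assms(5)
proof (induction arbitrary: v rule: K_check_H_induct)
  case (gen i) then show ?case by (rule assms(4))
qed (use assms(3) in \<open>auto simp: is_repD[OF assms(1)] is_repD[OF assms(2)] Vector_Spaces.linear_iff\<close>)

lemma rep_invariant:
  assumes \<rho>: "is_rep k sc \<rho>" and W: "module.subspace sc W"
    and "\<And>i v. i \<in> {1, 2} \<Longrightarrow> v \<in> W \<Longrightarrow> \<rho> (P k i) v \<in> W"
    and "h \<in> K_check_H k" "v \<in> W"
  shows "\<rho> h v \<in> W"
  using assms(4,5)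
proof (induction arbitrary: v rule: K_check_H_induct)
  case (gen i) then show ?case using assms(3) by blast
next
  interpret vector_space sc by (rule is_repD(1)[OF \<rho>])
  case (add f g) then show ?case using W by (simp add: is_repD[OF \<rho>] subspace_add)
next
  interpret vector_space sc by (rule is_repD(1)[OF \<rho>])
  case (smul c f) then show ?case using W by (simp add: is_repD[OF \<rho>] subspace_scale)
qed (simp_all add: is_repD[OF \<rho>])

lemma is_irrepI:
  fixes \<rho> :: "tensor \<Rightarrow> 'v \<Rightarrow> 'v::ab_group_add" and v :: 'v
  assumes "is_rep k sc \<rho>" "v \<noteq> 0"
    and "\<And>W w. module.subspace sc W \<Longrightarrow> (\<And>i v. i \<in> {1, 2} \<Longrightarrow> v \<in> W \<Longrightarrow> \<rho> (P k i) v \<in> W) \<Longrightarrow>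
      w \<in> W \<Longrightarrow> w \<noteq> 0 \<Longrightarrow> W = UNIV"
  shows "is_irrep k sc \<rho>"
proof -
  interpret vector_space sc by (rule is_repD(1)[OF assms(1)])
  have "W = {0} \<or> W = UNIV"
    if W: "subspace W" "\<forall>h\<in>K_check_H k. \<forall>v\<in>W. \<rho> h v \<in> W" for W
  proof (cases "\<exists>w\<in>W. w \<noteq> 0")
    case True
    then show ?thesis using assms(3)[OF W(1)] W(2) K_check_H_closed(2)[of _ k] by blast
  next
    case False
    then show ?thesis using subspace_0[OF W(1)] by blast
  qed
  then show ?thesis using assms(1,2) by (auto simp: is_irrep_def)
qed

lemma irrep_invariant:
  assumes "is_irrep k sc \<rho>" "module.subspace sc W"
    and "\<And>i v. i \<in> {1, 2} \<Longrightarrow> v \<in> W \<Longrightarrow> \<rho> (P k i) v \<in> W"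
    and "w \<in> W" "w \<noteq> 0"
  shows "v \<in> W"
proof -
  have \<rho>: "is_rep k sc \<rho>" using assms(1) by (simp add: is_irrep_def)
  have "\<forall>h\<in>K_check_H k. \<forall>v\<in>W. \<rho> h v \<in> W"
    using rep_invariant[OF \<rho> assms(2,3)] by blast
  then have "W = {0} \<or> W = UNIV" using assms(1,2) by (auto simp: is_irrep_def)
  then show ?thesis using assms(4,5) by auto
qed

text \<open>Kernel and range are invariant under the generators. The map leaves the explicit module,
  where coordinates define it, so the required isomorphism is its inverse.\<close>

lemma schur:
  assumes \<sigma>: "is_irrep k sc' \<sigma>" and \<rho>: "is_irrep k sc \<rho>" and \<psi>: "Vector_Spaces.linear sc' sc \<psi>"
    and P: "\<And>i v. i \<in> {1, 2} \<Longrightarrow> \<psi> (\<sigma> (P k i) v) = \<rho> (P k i) (\<psi> v)"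
    and nz: "\<psi> w \<noteq> 0"
  shows "rep_iso k sc \<rho> sc' \<sigma>"
proof -
  have reps: "is_rep k sc \<rho>" "is_rep k sc' \<sigma>" using \<rho> \<sigma> by (simp_all add: is_irrep_def)
  interpret Vector_Spaces.linear sc' sc \<psi> by (rule \<psi>)
  have "v = 0" if "\<psi> v = 0" for v
  proof (rule ccontr)
    assume "v \<noteq> 0"
    have "w \<in> {v. \<psi> v = 0}"
    proof (rule irrep_invariant[OF \<sigma> _ _ _ \<open>v \<noteq> 0\<close>])
      show "vs1.subspace {v. \<psi> v = 0}" by (rule subspace_kernel)
      show "\<sigma> (P k i) v \<in> {v. \<psi> v = 0}" if "i \<in> {1, 2}" "v \<in> {v. \<psi> v = 0}" for i v
        using that is_repD(3)[OF reps(1) K_check_H_closed(2)[OF that(1)], of 0 0]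
        by (simp add: P)
    qed (simp add: that)
    with nz show False by simp
  qed
  then have "inj \<psi>" using inj_on_iff_eq_0[OF vs1.subspace_UNIV] by auto
  moreover have "surj \<psi>"
  proof -
    have "v \<in> range \<psi>" for v
    proof (rule irrep_invariant[OF \<rho>, where w = "\<psi> w"])
      show "vs2.subspace (range \<psi>)" by (rule subspace_image) simp
      show "\<rho> (P k i) v \<in> range \<psi>" if "i \<in> {1, 2}" "v \<in> range \<psi>" for i v
        using that by (auto simp flip: P)
    qed (simp_all add: nz)
    then show ?thesis by blast
  qed
  ultimately have bij: "bij \<psi>" by (rule bijI)
  have inv1: "inv \<psi> (\<psi> v) = v" and inv2: "\<psi> (inv \<psi> w) = w" for v w
    using bij by (simp_all add: bij_is_inj bij_is_surj surj_f_inv_f)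
  have "inv \<psi> (a + b) = inv \<psi> a + inv \<psi> b" "inv \<psi> (sc c a) = sc' c (inv \<psi> a)" for a b c
    by (metis inv1 inv2 add) (metis inv1 inv2 scale)
  then have "Vector_Spaces.linear sc sc' (inv \<psi>)"
    using is_repD(1)[OF reps(1)] is_repD(1)[OF reps(2)] by (simp add: Vector_Spaces.linear_iff)
  moreover have "inv \<psi> (\<rho> h v) = \<sigma> h (inv \<psi> v)" if "h \<in> K_check_H k" for h v
    using rep_intertwines[OF reps(2,1) \<psi> P that] by (metis inv1 inv2)
  ultimately show ?thesis
    unfolding rep_iso_def using bij_imp_bij_inv[OF bij] by blast
qed

lemma extends_eps_tensor:
  assumes "extends_to_rep j sc A1 A2 \<rho>" "j \<le> k"
  shows "extends_to_rep k sc (\<lambda>v. sc (two ^ (k - j)) (A1 v)) (\<lambda>v. sc (two ^ (k - j)) (A2 v)) (eps_tensor k j \<rho>)"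
proof -
  have \<rho>: "is_rep j sc \<rho>" using assms(1) by (simp add: extends_to_rep_def)
  note mem = eps_contract_in_K_check_H[OF _ assms(2)]
  have tm: "eps_contract k j (tmult k g h) = tmult j (eps_contract k j g) (eps_contract k j h)"
    if "g \<in> K_check_H k" "h \<in> K_check_H k" for g h
    using that K_check_H_subset_pures assms(2) by (intro eps_contract_tmult) auto
  have "is_rep k sc (eps_tensor k j \<rho>)"
    by (simp add: is_rep_def eps_tensor_def is_repD[OF \<rho>] mem tm eps_contract_tone assms(2)
      eps_contract_linear Vector_Spaces.linear_iff)
  then show ?thesis
    using assms by (simp add: extends_to_rep_def eps_tensor_def eps_contract_P is_repD(7)[OF \<rho>]
        K_check_H_closed fun_eq_iff)
qed

subsection \<open>One-dimensional representations\<close>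

text \<open>For k = 0 the algebra consists of scalars and P_i is the unit; contracting all k factors
  scales this by [2]^k.\<close>

lemma is_check_eps_plus_exists: "\<exists>\<rho>. is_check_eps_plus k \<rho>"
proof -
  have t0: "tuples 0 = {[]}" by (auto simp: tuples_def)
  have pure0: "pure [] [] = 1" by (simp add: pure_def t0)
  have "extends_to_rep 0 (*) (\<lambda>v. v) (\<lambda>v. v) (\<lambda>f v. f [] * v)"
    by (simp add: extends_to_rep_def is_rep_def Vector_Spaces.linear_iff algebra_simps tensor_apply
        vector_space_over_itself.vector_space_axioms tone_def pure0 tmult_def t0 P_eq_refl_tensor refl_tensor_def)
  from extends_eps_tensor[OF this, of k] show ?thesis
    by (auto simp: is_check_eps_plus_def)
qed

text \<open>The sign character sends T_s to -1/u, the other root of the quadratic relation.\<close>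

definition sign_T :: "perm3 \<Rightarrow> K" where
  "sign_T w = (- inverse u) ^ len w"

definition sign_H :: "hecke \<Rightarrow> K" where
  "sign_H h = (\<Sum>w\<in>S3. h w * sign_T w)"

lemma sign_H_hmult: "sign_H (hmult g h) = sign_H g * sign_H h"
  using u_nonzero unfolding sign_H_def sum_S3
  by (simp only: hmult_eq lmul_id lmul_values sign_T_def len_values)
    (simp add: field_simps power2_eq_square power3_eq_cube)

lemma sign_H_T: "w \<in> S3 \<Longrightarrow> sign_H (T w) = sign_T w"
  by (simp add: sign_H_def T_def if_distrib[of "\<lambda>c. c * _"] finite_S3 cong: if_cong)

lemma sign_H_refl_H: "i \<in> {1, 2} \<Longrightarrow> sign_H (refl_H i) = - 1"
proof -
  assume i: "i \<in> {1, 2}"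
  have "sign_H (refl_H i) = 2 / two * sign_H (T (simple i)) + (inverse u - u) / two * sign_H (T id)"
    by (simp add: sign_H_def refl_H_def algebra_simps sum.distrib sum_distrib_left sum_subtractf sum_divide_distrib
        diff_divide_distrib)
  also have "sign_H (T (simple i)) = - inverse u"
    using i by (auto simp: sign_H_T sign_T_def len_values)
  also have "sign_H (T id) = 1" by (simp add: sign_H_T sign_T_def len_values)
  also have "2 / two * - inverse u + (inverse u - u) / two * 1 = - (two / two)"
    unfolding add_divide_distrib[symmetric] by (simp add: two_def field_simps)
  finally show ?thesis by simp
qed

text \<open>For k = 1 this is the sign character, which sends R_i to -1 and hence P_i to 0; the
  other k - 1 factors are contracted.\<close>

lemma is_check_eps_minus_exists:
  assumes "k \<ge> 1"
  shows "\<exists>\<rho>. is_check_eps_minus k \<rho>"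
proof -
  define \<sigma> where "\<sigma> f = (\<Sum>w\<in>S3. f [w] * sign_T w)" for f :: tensor
  have lin: "\<sigma> (f + g) = \<sigma> f + \<sigma> g" "\<sigma> (smul c f) = c * \<sigma> f" "\<sigma> 0 = 0" for f g c
    by (simp_all add: \<sigma>_def tensor_apply algebra_simps sum.distrib sum_distrib_left)
  have s_pure: "\<sigma> (pure [h]) = sign_H h" for h
    unfolding sign_H_def \<sigma>_def
    by (intro sum.cong refl) (auto simp: pure_def tuples_def One_nat_def)
  have "\<sigma> (tmult 1 f g) = \<sigma> f * \<sigma> g" if "f \<in> K_check_H 1" "g \<in> K_check_H 1" for f g
  proof -
    have "f \<in> pures 1" "g \<in> pures 1" using that K_check_H_subset_pures by blast+
    then show ?thesis
    proof (rule pures_bilinear_induct)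
      fix gs hs :: "hecke list" assume len: "length gs = 1" "length hs = 1"
      then obtain g h where gh: "gs = [g]" "hs = [h]" by (auto simp: length_Suc_conv One_nat_def)
      then show "\<sigma> (tmult 1 (pure gs) (pure hs)) = \<sigma> (pure gs) * \<sigma> (pure hs)"
        using tmult_pure[OF len] by (simp add: s_pure sign_H_hmult)
    qed (simp_all add: lin tmult_linear algebra_simps)
  qed
  moreover have "\<sigma> (tone 1) = 1"
    using s_pure[of "T id"] by (simp add: tone_def sign_H_T sign_T_def len_values One_nat_def)
  moreover have "\<sigma> (P 1 i) = 0" if "i \<in> {1, 2}" for i
    using s_pure[of "refl_H i"] calculation(2) sign_H_refl_H[OF that]
    by (simp add: P_eq_refl_tensor lin refl_tensor_def One_nat_def)
  ultimately have "extends_to_rep 1 (*) (\<lambda>v. 0) (\<lambda>v. 0) (\<lambda>f v. \<sigma> f * v)"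
    by (simp add: extends_to_rep_def is_rep_def Vector_Spaces.linear_iff algebra_simps lin
        vector_space_over_itself.vector_space_axioms)
  from extends_eps_tensor[OF this assms] show ?thesis
    by (auto simp: is_check_eps_minus_def)
qed

subsection \<open>Two-dimensional representations\<close>

lemma matrix_2_apply:
  "(vector [vector [a, b], vector [c, d]] :: K^2^2) *v v = vector [a * v $ 1 + b * v $ 2, c * v $ 1 + d * v $ 2]"
  by (simp add: vec_eq_iff forall_2 matrix_vector_mult_def sum_2)

lemma is_check_X_exists:
  assumes "j \<ge> 1"
  shows "\<exists>\<rho>. is_check_X j ((two ^ j * a_cheb j)\<^sup>2) \<rho>"
proof -
  let ?p = "two ^ j"
  let ?c = "(?p * a_cheb j)\<^sup>2"
  define s where "s = qim (omega ^ j)"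
  \<comment> \<open>This makes 1 and the element \<open>e\<close> below a basis.\<close>
  have s: "s \<noteq> 0"
    using qim_omega_power[of j] cos2_square_ne_1[OF assms] by (auto simp: s_def)
  have oj: "qconj omega ^ j = Quad (cos2 j) (- s)"
    by (rule quad.expand) (simp add: s_def qre_omega_power flip: qconj_power)
  define m where "m = ?p / 2"
  have p: "?p = 2 * m" and m: "m \<noteq> 0" by (simp_all add: m_def)
  \<comment> \<open>This is P_2 applied to 1. The parameter of the module appears as P_1 e = 2 m^2
    (\<open>cos2 j\<close> + 1) = 4 m^2 a_j^2.\<close>
  define e where "e = Quad (m * (cos2 j + 1)) (- (m * s))"
  define \<phi> :: "K^2 \<Rightarrow> quad" where "\<phi> v = quad_of (v $ 1) + qscale (v $ 2) e" for v
  have \<phi>_sel: "qre (\<phi> v) = v $ 1 + v $ 2 * (m * (cos2 j + 1))" "qim (\<phi> v) = - (v $ 2 * (m * s))" for v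
    by (simp_all add: \<phi>_def qscale_def e_def)
  have lin: "Vector_Spaces.linear (*s) qscale \<phi>"
    by (simp add: Vector_Spaces.linear_iff vec.vector_space_axioms vector_space_qscale \<phi>_def
        quad_of_hom algebra_simps)
      (simp add: qscale_def quad_of_hom)
  have "bij \<phi>"
  proof (rule bijI)
    show "inj \<phi>"
    proof (rule injI)
      fix v w assume "\<phi> v = \<phi> w"
      then have "qre (\<phi> v) = qre (\<phi> w)" "qim (\<phi> v) = qim (\<phi> w)" by simp_all
      then show "v = w" using s m by (simp add: \<phi>_sel vec_eq_iff forall_2)
    qed
    show "surj \<phi>"
    proof (rule surjI)
      fix l
      let ?b = "- (qim l / (m * s))"
      show "\<phi> (vector [qre l - ?b * (m * (cos2 j + 1)), ?b]) = l"
        using s m by (intro quad.expand) (simp add: \<phi>_sel)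
    qed
  qed
  let ?\<rho> = "\<lambda>h v. inv \<phi> (rho j h (\<phi> v))"
  have P: "rho j (P j 1) l = qscale m (qconj l + l)"
    "rho j (P j 2) l = qscale m (qconj omega ^ j * qconj l + l)" for l
    using assms by (simp_all add: P_eq_refl_tensor rho_linear_left rho_refl rho_tone m_def)
  have "rho j (P j 1) (\<phi> v) = \<phi> (vector [?p * v $ 1 + ?c * v $ 2, 0])" for v
    unfolding p by (rule quad.expand) (simp add: P \<phi>_sel qscale_def cos2_def power2_eq_square algebra_simps)
  moreover have "rho j (P j 2) (\<phi> v) = \<phi> (vector [0, v $ 1 + ?p * v $ 2])" for v
  proof -
    \<comment> \<open>Norm 1 of \<open>omega ^ j\<close>, which accounts for P_2 e = 2 m e.\<close>
    have s2: "disc * (s * s) = cos2 j * cos2 j - 1"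
      using qim_omega_power[of j] by (simp add: s_def power2_eq_square algebra_simps)
    have "m * (c * (a + b * (m * (c + 1))) + d * (- s * (b * (m * s))) + (a + b * (m * (c + 1))))
        = (a + 2 * m * b) * (m * (c + 1))"
      if "d * (s * s) = c * c - 1" for a b c d s :: K
      using that by algebra
    note re = this[OF s2]
    have "qre (rho j (P j 2) (\<phi> v)) = m * (cos2 j * qre (\<phi> v) + disc * (- s * - qim (\<phi> v)) + qre (\<phi> v))"
      "qim (rho j (P j 2) (\<phi> v)) = m * (cos2 j * - qim (\<phi> v) + - s * qre (\<phi> v) + qim (\<phi> v))"
      by (simp_all add: P qscale_def oj)
    then show ?thesis
      unfolding p \<phi>_sel
      by (intro quad.expand conjI) (simp_all only: \<phi>_sel vector_2 minus_minus add_0 re, simp add: algebra_simps)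
  qed
  ultimately have "?\<rho> (P j 1) v = vector [?p * v $ 1 + ?c * v $ 2, 0]"
    "?\<rho> (P j 2) v = vector [0, v $ 1 + ?p * v $ 2]" for v
    using \<open>bij \<phi>\<close> by (simp_all add: bij_is_inj)
  then have "is_check_X j ?c ?\<rho>"
    using is_rep_transport[OF is_rep_rho[OF assms] lin \<open>bij \<phi>\<close>]
    by (simp add: is_check_X_def extends_to_rep_def fun_eq_iff matrix_2_apply)
  then show ?thesis by blast
qed

lemma check_eps_plus: "extends_to_rep k (*) (\<lambda>v. two ^ k * v) (\<lambda>v. two ^ k * v) (check_eps_plus k)"
  using someI_ex[OF is_check_eps_plus_exists[of k]] by (simp add: check_eps_plus_def is_check_eps_plus_def)

lemma check_eps_minus: "k \<ge> 1 \<Longrightarrow> extends_to_rep k (*) (\<lambda>v. 0) (\<lambda>v. 0) (check_eps_minus k)"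
  using someI_ex[OF is_check_eps_minus_exists[of k]] by (simp add: check_eps_minus_def is_check_eps_minus_def)

lemma eps_tensor_check_M:
  assumes "1 \<le> j" "j \<le> k"
  shows "is_rep k (*s) (eps_tensor k j (check_M j))"
    "eps_tensor k j (check_M j) (P k 1) v
      = vector [two ^ k * v $ 1 + two ^ (k - j) * (two ^ j * a_cheb j)\<^sup>2 * v $ 2, 0]"
    "eps_tensor k j (check_M j) (P k 2) v = vector [0, two ^ (k - j) * v $ 1 + two ^ k * v $ 2]"
proof -
  have "is_check_X j ((two ^ j * a_cheb j)\<^sup>2) (check_M j)"
    using someI_ex[OF is_check_X_exists[OF assms(1)]] by (simp add: check_M_def check_X_def)
  note ext = extends_eps_tensor[OF this[unfolded is_check_X_def] assms(2)]
  show "is_rep k (*s) (eps_tensor k j (check_M j))"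
    using ext by (simp add: extends_to_rep_def)
  have pow: "two ^ (k - j) * (two ^ j * c) = two ^ k * c" for c
    using assms(2) by (simp add: power_add[symmetric] mult.assoc[symmetric])
  show "eps_tensor k j (check_M j) (P k 1) v
      = vector [two ^ k * v $ 1 + two ^ (k - j) * (two ^ j * a_cheb j)\<^sup>2 * v $ 2, 0]"
    "eps_tensor k j (check_M j) (P k 2) v = vector [0, two ^ (k - j) * v $ 1 + two ^ k * v $ 2]"
    using ext
    by (simp_all add: extends_to_rep_def matrix_2_apply vec_eq_iff forall_2 distrib_left pow mult.assoc)
qed

section \<open>Irreducibility and pairwise non-isomorphism of the listed modules\<close>

lemma is_irrep_one_dim:
  assumes "is_rep k (*) \<rho>"
  shows "is_irrep k (*) (\<rho> :: tensor \<Rightarrow> K \<Rightarrow> K)"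
proof (rule is_irrepI[OF assms one_neq_zero])
  fix W and w :: K
  assume W: "module.subspace (*) W" "w \<in> W" "w \<noteq> 0"
  show "W = UNIV"
  proof (rule UNIV_eq_I[symmetric])
    fix v show "v \<in> W"
      using vector_space_over_itself.subspace_scale[OF W(1,2), of "v / w"] W(3) by simp
  qed
qed

text \<open>P_1 and P_2 map onto the two coordinate axes. They cannot both kill a nonzero vector,
  since their nonzero rows have determinant [2]^(2k) (1 - a_j^2); and each axis is mapped onto the
  other, as a_j is nonzero.\<close>

lemma is_irrep_check_M:
  assumes "1 \<le> j" "j \<le> k"
  shows "is_irrep k (*s) (eps_tensor k j (check_M j))"
proof (rule is_irrepI[OF eps_tensor_check_M(1)[OF assms]])
  show "(vector [1, 0] :: K^2) \<noteq> 0" by (simp add: vec_eq_iff forall_2)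
  fix W and w :: "K^2"
  let ?\<rho> = "eps_tensor k j (check_M j)"
  let ?c = "two ^ (k - j) * (two ^ j * a_cheb j)\<^sup>2" and ?d = "two ^ (k - j)" and ?p = "two ^ k"
  assume W: "vec.subspace W" "\<And>i v. i \<in> {1, 2} \<Longrightarrow> v \<in> W \<Longrightarrow> ?\<rho> (P k i) v \<in> W" "w \<in> W" "w \<noteq> 0"
  have P: "vector [?p * v $ 1 + ?c * v $ 2, 0] \<in> W" "vector [0, ?d * v $ 1 + ?p * v $ 2] \<in> W"
    if "v \<in> W" for v
    using W(2)[of 1, OF _ that] W(2)[of 2, OF _ that] by (simp_all add: eps_tensor_check_M[OF assms])
  have scale: "vector [a * x, a * y] \<in> W" if "vector [x, y] \<in> W" for a x y :: K
  proof -
    have "a *s vector [x, y] = (vector [a * x, a * y] :: K^2)" by (simp add: vec_eq_iff forall_2)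
    then show ?thesis using vec.subspace_scale[OF W(1) that, of a] by simp
  qed
  have nz: "?c \<noteq> 0" "?d \<noteq> 0" "?p \<noteq> 0" by (simp_all add: a_cheb_nonzero)
  have pp: "?p = two ^ (k - j) * two ^ j" using assms(2) by (simp flip: power_add)
  have det: "?p * ?p - ?c * ?d \<noteq> 0"
  proof -
    have "(a_cheb j)\<^sup>2 \<noteq> (a_cheb 0)\<^sup>2" using a_cheb_square_inj[of j 0] assms(1) by auto
    moreover have "?p * ?p - ?c * ?d = ?p * ?p * (1 - (a_cheb j)\<^sup>2)"
      unfolding pp by (simp add: power2_eq_square algebra_simps)
    ultimately show ?thesis using nz(3) by simp
  qed
  have e1: "vector [1, 0] \<in> W" if "vector [x, 0] \<in> W" "x \<noteq> 0" for x
    using scale[OF that(1), of "1 / x"] that(2) by simp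
  have e2: "vector [0, 1] \<in> W" if "vector [0, x] \<in> W" "x \<noteq> 0" for x
    using scale[OF that(1), of "1 / x"] that(2) by simp
  have "(vector [1, 0] :: K^2) \<in> W \<and> (vector [0, 1] :: K^2) \<in> W"
  proof (cases "?p * w $ 1 + ?c * w $ 2 = 0")
    case False
    then have 1: "(vector [1, 0] :: K^2) \<in> W" using e1 P(1)[OF W(3)] by blast
    then show ?thesis using P(2)[OF 1] e2[of ?d] nz by simp
  next
    case True
    have "?d * w $ 1 + ?p * w $ 2 \<noteq> 0"
    proof
      assume *: "?d * w $ 1 + ?p * w $ 2 = 0"
      \<comment> \<open>Cramer's rule for the two vanishing coordinates.\<close>
      have x: "(p * p - c * d) * x = p * (p * x + c * y) - c * (d * x + p * y)"
        and y: "(p * p - c * d) * y = p * (d * x + p * y) - d * (p * x + c * y)" for p c d x y :: K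
        by (simp_all add: algebra_simps)
      have "(?p * ?p - ?c * ?d) * w $ 1 = 0"
        unfolding x[where y = "w $ 2"] True * by (simp only: mult_zero_right diff_self)
      moreover have "(?p * ?p - ?c * ?d) * w $ 2 = 0"
        unfolding y[where x = "w $ 1"] True * by (simp only: mult_zero_right diff_self)
      ultimately have "w $ 1 = 0" "w $ 2 = 0" using det by (simp_all only: mult_eq_0_iff simp_thms)
      with W(4) show False by (simp add: vec_eq_iff forall_2)
    qed
    then have 2: "(vector [0, 1] :: K^2) \<in> W" using e2 P(2)[OF W(3)] by blast
    then show ?thesis using P(1)[OF 2] e1[of ?c] nz by simp
  qed
  note e = conjunct1[OF this] conjunct2[OF this]
  show "W = UNIV"
  proof (rule UNIV_eq_I[symmetric])
    fix v :: "K^2"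
    have "v = v $ 1 *s vector [1, 0] + v $ 2 *s vector [0, 1]" by (simp add: vec_eq_iff forall_2)
    then show "v \<in> W" using e by (metis vec.subspace_add vec.subspace_scale W(1))
  qed
qed

lemma rep_isoE:
  assumes "rep_iso k sc \<rho> sc' \<sigma>"
  obtains \<phi> where "\<And>a v. \<phi> (sc a v) = sc' a (\<phi> v)" "\<And>h v. h \<in> K_check_H k \<Longrightarrow> \<phi> (\<rho> h v) = \<sigma> h (\<phi> v)" "inj \<phi>" "surj \<phi>" "\<phi> 0 = 0"
proof -
  obtain \<phi> where \<phi>: "Vector_Spaces.linear sc sc' \<phi>" "bij \<phi>" "\<And>h v. h \<in> K_check_H k \<Longrightarrow> \<phi> (\<rho> h v) = \<sigma> h (\<phi> v)"
    using assms by (auto simp: rep_iso_def)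
  interpret Vector_Spaces.linear sc sc' \<phi> by (rule \<phi>(1))
  show ?thesis using \<phi> by (intro that[of \<phi>]) (auto simp: scale zero bij_def)
qed

lemma eps_not_iso: "k \<ge> 1 \<Longrightarrow> \<not> rep_iso k (*) (check_eps_plus k) (*) (check_eps_minus k)"
proof
  assume k: "k \<ge> 1" and "rep_iso k (*) (check_eps_plus k) (*) (check_eps_minus k)"
  then obtain \<phi> :: "K \<Rightarrow> K" where \<phi>: "\<And>h v. h \<in> K_check_H k \<Longrightarrow> \<phi> (check_eps_plus k h v) = check_eps_minus k h (\<phi> v)" "inj \<phi>" "\<phi> 0 = 0"
    by (elim rep_isoE) auto
  have "\<phi> (two ^ k * 1) = 0"
    using \<phi>(1)[OF K_check_H_closed(2)[of 1 k], of 1] check_eps_plus[of k] check_eps_minus[OF k]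
    by (simp add: extends_to_rep_def)
  then show False using injD[OF \<phi>(2), of "two ^ k * 1" 0] \<phi>(3) by simp
qed

text \<open>An isomorphism would make P_1 scalar on the two-dimensional module, but it maps
  \<open>vector [0, 1]\<close> to a nonzero vector on the other axis.\<close>

lemma scalar_not_iso:
  assumes "1 \<le> j" "j \<le> k" and \<rho>: "\<And>v. \<rho> (P k 1) v = c * v"
    and iso: "rep_iso k (*) \<rho> (*s) (eps_tensor k j (check_M j))"
  shows False
proof -
  from iso obtain \<phi> where \<phi>: "\<And>a v. \<phi> (a * v) = a *s \<phi> v"
    "\<And>h v. h \<in> K_check_H k \<Longrightarrow> \<phi> (\<rho> h v) = eps_tensor k j (check_M j) h (\<phi> v)" "surj \<phi>"
    by (elim rep_isoE) auto
  have *: "eps_tensor k j (check_M j) (P k 1) w = c *s w" for w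
    using \<phi>(2)[OF K_check_H_closed(2)[of 1 k]] \<phi>(3) \<rho> \<phi>(1) by (metis insertI1 surjD)
  from *[of "vector [0, 1]"] show False
    using a_cheb_nonzero[of j]
    by (simp add: eps_tensor_check_M[OF assms(1,2)] vec_eq_iff forall_2)
qed

text \<open>On the j-th module P_1 P_2 P_1 = [2]^(2k) a_j^2 P_1 with P_1 nonzero, so the isomorphism
  class determines a_j^2.\<close>

lemma check_M_not_iso:
  assumes ij: "1 \<le> i" "i \<le> k" "1 \<le> j" "j \<le> k"
    and iso: "rep_iso k (*s) (eps_tensor k i (check_M i)) (*s) (eps_tensor k j (check_M j))"
  shows "i = j"
proof -
  let ?R = "\<lambda>j. eps_tensor k j (check_M j)"
  from iso obtain \<phi> where \<phi>: "\<And>a v. \<phi> (a *s v) = a *s \<phi> v"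
    "\<And>h v. h \<in> K_check_H k \<Longrightarrow> \<phi> (?R i h v) = ?R j h (\<phi> v)" "surj \<phi>"
    by (elim rep_isoE) auto
  have P: "\<phi> (?R i (P k 1) v) = ?R j (P k 1) (\<phi> v)" "\<phi> (?R i (P k 2) v) = ?R j (P k 2) (\<phi> v)" for v
    using \<phi>(2) K_check_H_closed(2)[of _ k] by auto
  have PPP: "?R j (P k 1) (?R j (P k 2) (?R j (P k 1) v)) = ((two ^ k)\<^sup>2 * (a_cheb j)\<^sup>2) *s ?R j (P k 1) v"
    if "1 \<le> j" "j \<le> k" for j v
  proof -
    have "two ^ k = two ^ (k - j) * two ^ j" using that by (simp flip: power_add)
    then show ?thesis
      by (simp add: eps_tensor_check_M[OF that] vec_eq_iff forall_2 power2_eq_square mult_ac)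
  qed
  obtain v where v: "\<phi> v = vector [1, 0]" using \<phi>(3) by (metis surjD)
  have "\<phi> (?R i (P k 1) (?R i (P k 2) (?R i (P k 1) v))) = ?R j (P k 1) (?R j (P k 2) (?R j (P k 1) (\<phi> v)))"
    by (simp only: P)
  then have "((two ^ k)\<^sup>2 * (a_cheb i)\<^sup>2) *s ?R j (P k 1) (\<phi> v) = ((two ^ k)\<^sup>2 * (a_cheb j)\<^sup>2) *s ?R j (P k 1) (\<phi> v)"
    by (simp only: PPP ij \<phi>(1) P)
  then have "(a_cheb i)\<^sup>2 = (a_cheb j)\<^sup>2"
    unfolding v by (simp add: eps_tensor_check_M[OF ij(3,4)] vec_eq_iff forall_2)
  then show ?thesis by (rule a_cheb_square_inj)
qed

section \<open>The minimal polynomial of \<open>R\<^sub>1 R\<^sub>2\<close>\<close>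

lemma lmul_linear: "lmul i (\<lambda>x. a * f x + b * g x) = (\<lambda>x. a * lmul i f x + b * lmul i g x)"
  by (rule ext) (simp add: lmul_def algebra_simps)

lemma hmult_refl_H:
  assumes "i \<in> {1, 2}"
  shows "hmult (refl_H i) h = (\<lambda>x. 2 / two * lmul i h x + (inverse u - u) / two * h x)"
proof -
  have *: "hmult (\<lambda>x. d * T id x) h = (\<lambda>x. d * h x)" for d
    using hmult_bilinear(1)[of d "T id" "\<lambda>_. 0" h] by (simp add: hmult_T_id hmult_eq[of "\<lambda>_. 0"])
  show ?thesis
    unfolding refl_H_def hmult_bilinear(1) hmult_T_simple[OF assms] * ..
qed

text \<open>A function of type \<open>hecke\<close> may be nonzero outside \<open>S3\<close>, where
  \<open>lmul\<close> returns 0; relations such as R^2 = 1 hold only for supported ones.\<close>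

definition supp_S3 :: "hecke \<Rightarrow> bool" where
  "supp_S3 h \<longleftrightarrow> (\<forall>w. w \<notin> S3 \<longrightarrow> h w = 0)"

lemma supp_S3_refl_H: "i \<in> {1, 2} \<Longrightarrow> supp_S3 h \<Longrightarrow> supp_S3 (hmult (refl_H i) h)"
  by (simp add: supp_S3_def hmult_refl_H lmul_outside)

lemma lmul_square:
  assumes "i \<in> {1, 2}" "supp_S3 h"
  shows "lmul i (lmul i h) = (\<lambda>x. h x + (u - inverse u) * lmul i h x)"
  using assms
  by (elim insertE emptyE; hypsubst; intro S3_ext)
    (simp add: supp_S3_def lmul_outside | simp only: lmul_id lmul_values)+

text \<open>By T^2 = 1 + q T, the square of a T + b is a^2 + b^2 + a (a q + 2 b) T.\<close>

lemma refl_H_invol: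
  assumes "i \<in> {1, 2}" "supp_S3 h"
  shows "hmult (refl_H i) (hmult (refl_H i) h) = h"
proof -
  have *: "a * (a * (h + q * l) + b * l) + b * (a * l + b * h) = h"
    if "a * q + 2 * b = 0" "a * a + b * b = 1" for a b h l q :: K
    using that by algebra
  have ab: "2 / two * (u - inverse u) + 2 * ((inverse u - u) / two) = 0"
    by (simp add: field_simps)
  have ab2: "2 / two * (2 / two) + (inverse u - u) / two * ((inverse u - u) / two) = 1"
  proof -
    have "2 / t * (2 / t) + - q / t * (- q / t) = 1" if "t\<^sup>2 = q\<^sup>2 + 4" "t \<noteq> 0" for t q :: K
    proof -
      have "2 / t * (2 / t) + - q / t * (- q / t) = (q\<^sup>2 + 4) / t\<^sup>2"
        by (simp add: power2_eq_square add_divide_distrib)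
      then show ?thesis using that by (metis divide_self power_not_zero)
    qed
    from this[OF two_square] show ?thesis by simp
  qed
  show ?thesis
    unfolding hmult_refl_H[OF assms(1)] lmul_linear lmul_square[OF assms] *[OF ab ab2] ..
qed

text \<open>The computation of \<open>T_quad_braid\<close> read backwards: now the braid relation is
  given.\<close>

lemma refl_H_braid:
  assumes "supp_S3 h"
  shows "hmult (refl_H 1) (hmult (refl_H 2) (hmult (refl_H 1) h)) x - hmult (refl_H 2) (hmult (refl_H 1) (hmult (refl_H 2) h)) x
    = (2 * cos2 1 + 1) * (hmult (refl_H 1) h x - hmult (refl_H 2) h x)"
proof -
  \<comment> \<open>The digits spell words in \<open>lmul\<close>; \<open>l121\<close> is the common
    value of the two words of length three and cancels.\<close>
  have *: "a * (a * (a * l121 + b * l12) + b * (a * l11 + b * l1)) + b * (a * (a * l21 + b * l2) + b * (a * l1 + b * h))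
    - (a * (a * (a * l121 + b * l21) + b * (a * l22 + b * l2)) + b * (a * (a * l12 + b * l1) + b * (a * l2 + b * h)))
    = d * ((a * l1 + b * h) - (a * l2 + b * h))"
    if "a * (a * (b * q) + b * b) = a * d" "l11 = h + q * l1" "l22 = h + q * l2"
    for a b d q h l1 l2 l11 l12 l21 l22 l121 :: K
    using that by algebra
  have "2 / two * (2 / two * ((inverse u - u) / two * (u - inverse u)) + (inverse u - u) / two * ((inverse u - u) / two))
    = 2 / two * (2 * cos2 1 + 1)"
  proof -
    have "2 / t * (2 / t * (- q / t * q) + - q / t * (- q / t)) = 2 / t * e" if "e * t\<^sup>2 = - (q\<^sup>2)" "t \<noteq> 0" for t q e :: K
    proof -
      have "e = - (q\<^sup>2) / t\<^sup>2" using that by (simp add: field_simps)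
      then show ?thesis using that(2) by (simp add: power2_eq_square field_simps)
    qed
    from this[OF cos2_1] show ?thesis by simp
  qed
  note * = *[OF this]
  have i: "(1::nat) \<in> {1, 2}" "(2::nat) \<in> {1, 2}" by simp_all
  show ?thesis
    unfolding hmult_refl_H[OF i(1)] hmult_refl_H[OF i(2)] lmul_linear lmul_square[OF i(1) assms]
      lmul_square[OF i(2) assms] lmul_braid
    by (rule *) (rule refl)+
qed

definition coxeter_pow :: "nat \<Rightarrow> hecke" where
  "coxeter_pow n = ((\<lambda>h. hmult (refl_H 1) (hmult (refl_H 2) h)) ^^ n) (T id)"

lemma coxeter_pow_simps:
  "coxeter_pow 0 = T id" "coxeter_pow (Suc n) = hmult (refl_H 1) (hmult (refl_H 2) (coxeter_pow n))"
  by (simp_all add: coxeter_pow_def)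

lemma supp_S3_coxeter_pow: "supp_S3 (coxeter_pow n)"
proof (induction n)
  case 0 show ?case by (auto simp: supp_S3_def coxeter_pow_simps T_def)
qed (simp add: coxeter_pow_simps supp_S3_refl_H)

text \<open>For G = R_1 R_2, \<open>refl_H_braid\<close> multiplied on the right by R_2 R_1 R_2 says
  G^3 - 1 = (2 \<open>cos2 1\<close> + 1) (G^2 - G), that is (G - 1) (G^2 - 2 \<open>cos2 1\<close>
  G + 1) = 0.\<close>

lemma coxeter_pow_recurrence:
  "coxeter_pow (n + 3) x = (2 * cos2 1 + 1) * (coxeter_pow (n + 2) x - coxeter_pow (n + 1) x) + coxeter_pow n x"
proof -
  let ?r = "\<lambda>i. hmult (refl_H i)" and ?e = "2 * cos2 1 + 1"
  have i: "(1::nat) \<in> {1, 2}" "(2::nat) \<in> {1, 2}" by simp_all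
  note supp = supp_S3_coxeter_pow supp_S3_refl_H[OF i(1)] supp_S3_refl_H[OF i(2)]
  note invol = refl_H_invol[OF i(1)] refl_H_invol[OF i(2)]
  let ?h = "coxeter_pow n"
  have "?r 1 (?r 2 (?r 1 (?r 2 (?r 1 (?r 2 ?h))))) x - ?r 2 (?r 1 (?r 2 (?r 2 (?r 1 (?r 2 ?h))))) x
    = ?e * (?r 1 (?r 2 (?r 1 (?r 2 ?h))) x - ?r 2 (?r 2 (?r 1 (?r 2 ?h))) x)"
    by (rule refl_H_braid) (intro supp)
  also have "?r 2 (?r 1 (?r 2 (?r 2 (?r 1 (?r 2 ?h))))) = ?h"
    by (simp add: invol supp)
  also have "?r 2 (?r 2 (?r 1 (?r 2 ?h))) = ?r 1 (?r 2 ?h)"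
    by (simp add: invol supp)
  finally show ?thesis
    by (simp add: coxeter_pow_simps numeral_3_eq_3 numeral_2_eq_2 One_nat_def algebra_simps)
qed

text \<open>A solution of the recurrence is \<open>\<alpha> + \<beta> w\<^sup>n + \<gamma> w\<^sup>-\<^sup>n\<close> with \<open>\<beta>\<close>, \<open>\<gamma>\<close> conjugate.\<close>

lemma recurrence_solution:
  fixes s :: "nat \<Rightarrow> K"
  assumes rec: "\<And>n. s (n + 3) = (2 * cos2 1 + 1) * (s (n + 2) - s (n + 1)) + s n"
  shows "\<exists>p. degree p \<le> 2 \<and> (\<forall>n. quad_of (s n) = qconj omega ^ n * poly p (omega ^ n))"
proof -
  let ?c = "cos2 1"
  have c: "?c \<noteq> 1" using cos2_square_ne_1[of 1] by auto
  \<comment> \<open>The operator X^2 - 2 \<open>cos2 1\<close> X + 1 kills the two conjugate terms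
    and multiplies the constant one by 2 - 2 \<open>cos2 1\<close>; then \<beta> is fitted to s 0
    and s 1.\<close>
  define a where "a = (s 2 - 2 * ?c * s 1 + s 0) / (2 - 2 * ?c)"
  define \<beta> where "\<beta> = Quad ((s 0 - a) / 2) ((s 1 - a - ?c * (s 0 - a)) / (2 * disc))"
  let ?f = "\<lambda>n. quad_of a + \<beta> * omega ^ n + qconj \<beta> * qconj omega ^ n"
  have cube: "omega ^ (n + 3) = quad_of (2 * ?c + 1) * (omega ^ (n + 2) - omega ^ (n + 1)) + omega ^ n" for n
  proof -
    have "omega ^ 3 = quad_of (2 * ?c + 1) * (omega\<^sup>2 - omega) + 1"
      unfolding omega_square power3_eq_cube
      by (simp add: quad.expand disc_def power2_eq_square algebra_simps)
    then have "omega ^ (n + 3) = omega ^ n * (quad_of (2 * ?c + 1) * (omega\<^sup>2 - omega) + 1)"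
      by (simp only: power_add)
    also have "\<dots> = quad_of (2 * ?c + 1) * (omega ^ (n + 2) - omega ^ (n + 1)) + omega ^ n"
      by (simp add: power_add power2_eq_square algebra_simps)
    finally show ?thesis .
  qed
  have cube': "qconj omega ^ (n + 3) = quad_of (2 * ?c + 1) * (qconj omega ^ (n + 2) - qconj omega ^ (n + 1)) + qconj omega ^ n" for n
  proof -
    have "qconj (omega ^ (n + 3)) = qconj (quad_of (2 * ?c + 1) * (omega ^ (n + 2) - omega ^ (n + 1)) + omega ^ n)"
      by (simp only: cube)
    then show ?thesis by (simp only: qconj_hom qconj_power)
  qed
  have f01: "quad_of (s 0) = ?f 0" "quad_of (s 1) = ?f 1"
    using disc_nonzero by (auto intro!: quad.expand simp: \<beta>_def field_simps)
  have f: "quad_of (s n) = ?f n" for n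
  proof (induction n rule: less_induct)
    case (less n)
    have "n = 0 \<or> n = 1 \<or> n = 2 \<or> (\<exists>m. n = m + 3)" by presburger
    then consider "n = 0" | "n = 1" | "n = 2" | m where "n = m + 3" by blast
    then show ?case
    proof cases
      case 1 then show ?thesis using f01 by simp
    next
      case 2 then show ?thesis using f01 by simp
    next
      case 3
      have "a * (2 - 2 * ?c) = s 2 - 2 * ?c * s 1 + s 0" using c by (simp add: a_def)
      then have s2: "s 2 = a + 2 * ?c * (s 1 - a) - (s 0 - a)" by (simp add: algebra_simps)
      have square: "qconj omega ^ 2 = quad_of (2 * ?c) * qconj omega - 1"
        using arg_cong[OF omega_square, of qconj] by (simp only: qconj_hom qconj_power)
      have "?f 2 = quad_of a + quad_of (2 * ?c) * (?f 1 - quad_of a) - (?f 0 - quad_of a)"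
        unfolding omega_square square by (simp add: algebra_simps)
      also have "\<dots> = quad_of (s 2)"
        unfolding f01[symmetric] s2 by (simp only: quad_of_hom)
      finally show ?thesis unfolding 3 by (rule sym)
    next
      case (4 m)
      have "quad_of (s n) = quad_of (2 * ?c + 1) * (quad_of (s (m + 2)) - quad_of (s (m + 1))) + quad_of (s m)"
        unfolding 4 rec by (simp only: quad_of_hom)
      also have "\<dots> = quad_of (2 * ?c + 1) * (?f (m + 2) - ?f (m + 1)) + ?f m"
        by (simp only: less 4)
      also have "\<dots> = ?f n"
        unfolding 4 cube cube' by (simp add: algebra_simps)
      finally show ?thesis .
    qed
  qed
  have "qconj omega ^ n * (omega ^ n * (omega ^ n * b)) = omega ^ n * b" "qconj omega ^ n * (omega ^ n * b) = b" for n b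
    by (simp_all add: omega_power_norm flip: mult.assoc)
  \<comment> \<open>The factor \<open>qconj omega ^ n\<close> clears the negative exponent, leaving
    a quadratic polynomial at \<open>omega ^ n\<close>.\<close>
  then have "quad_of (s n) = qconj omega ^ n * poly [:qconj \<beta>, quad_of a, \<beta>:] (omega ^ n)" for n
    unfolding f by (simp add: algebra_simps)
  moreover have "degree [:qconj \<beta>, quad_of a, \<beta>:] \<le> 2" by simp
  ultimately show ?thesis by blast
qed

lemma poly_bounded:
  fixes p :: "'a::comm_semiring_1 poly"
  assumes "degree p \<le> d"
  shows "poly p y = (\<Sum>m\<le>d. coeff p m * y ^ m)"
  unfolding poly_altdef
  using assms by (intro sum.mono_neutral_left) (auto simp: coeff_eq_0)

text \<open>A coefficient of the tensor power is a product of k values of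
  \<open>recurrence_solution\<close>, so it is a polynomial of degree at most 2 k in w^n,
  independent of n, times w^(-k n).\<close>

lemma coxeter_tensor_expansion:
  assumes "x \<in> tuples k"
  shows "\<exists>b. \<forall>n. quad_of (pure (replicate k (coxeter_pow n)) x)
    = (\<Sum>m\<le>2 * k. b m * (qconj omega ^ k * omega ^ m) ^ n)"
proof -
  have "\<exists>p. \<forall>w. degree (p w) \<le> 2 \<and> (\<forall>n. quad_of (coxeter_pow n w) = qconj omega ^ n * poly (p w) (omega ^ n))"
    by (intro choice allI recurrence_solution coxeter_pow_recurrence)
  then obtain p where p: "\<And>w. degree (p w) \<le> 2"
      "\<And>w n. quad_of (coxeter_pow n w) = qconj omega ^ n * poly (p w) (omega ^ n)"
    by blast
  let ?q = "\<Prod>i<k. p (x ! i)"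
  have "degree ?q \<le> sum (degree \<circ> (\<lambda>i. p (x ! i))) {..<k}" by (rule degree_prod_sum_le) simp
  also have "\<dots> \<le> (\<Sum>i<k. 2)" by (intro sum_mono) (simp add: p(1))
  finally have deg: "degree ?q \<le> 2 * k" by simp
  have "quad_of (pure (replicate k (coxeter_pow n)) x) = (\<Sum>m\<le>2 * k. coeff ?q m * (qconj omega ^ k * omega ^ m) ^ n)" for n
  proof -
    have "quad_of (pure (replicate k (coxeter_pow n)) x) = (\<Prod>i<k. qconj omega ^ n * poly (p (x ! i)) (omega ^ n))"
      using assms by (simp add: pure_def quad_of_prod p(2))
    also have "\<dots> = (qconj omega ^ n) ^ k * poly ?q (omega ^ n)"
      by (simp add: prod.distrib poly_prod)
    also have "\<dots> = (\<Sum>m\<le>2 * k. coeff ?q m * (qconj omega ^ k * omega ^ m) ^ n)"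
      unfolding poly_bounded[OF deg] sum_distrib_left
      by (simp add: power_mult_distrib mult_ac flip: power_mult)
    finally show ?thesis .
  qed
  then show ?thesis by blast
qed

text \<open>\<open>coxeter_quot k j 0\<close> is the product of the factors \<open>G\<^sup>2 - 2 cos2 i G + 1\<close>, \<open>i < j\<close>, where
  \<open>G = R\<^sub>1 R\<^sub>2\<close> in the tensor power.\<close>

fun coxeter_quot :: "nat \<Rightarrow> nat \<Rightarrow> nat \<Rightarrow> tensor" where
  "coxeter_quot k 0 n = pure (replicate k (coxeter_pow n))"
| "coxeter_quot k (Suc j) n
    = coxeter_quot k j (Suc (Suc n)) + smul (- (2 * cos2 j)) (coxeter_quot k j (Suc n)) + coxeter_quot k j n"

lemma coxeter_quot_outside: "x \<notin> tuples k \<Longrightarrow> coxeter_quot k j n x = 0"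
  by (induction j arbitrary: n) (simp_all add: tensor_apply, simp add: pure_def)

text \<open>Passing to the next quotient multiplies the coefficient of t^n by t^2 - 2
  \<open>cos2 i\<close> t + 1. The exponents t = w^(m - k) all satisfy one of these equations,
  namely that with i = |m - k|, which is at most k.\<close>

lemma coxeter_quot_eq_0: "coxeter_quot k (Suc k) n = 0"
proof
  fix x
  show "coxeter_quot k (Suc k) n x = 0 x"
  proof (cases "x \<in> tuples k")
    case False
    then show ?thesis by (simp only: coxeter_quot_outside[OF False] zero_fun_apply)
  next
    case True
    let ?t = "\<lambda>m. qconj omega ^ k * omega ^ m"
    let ?q = "\<lambda>i m. (?t m)\<^sup>2 - quad_of (2 * cos2 i) * ?t m + 1"
    obtain b where b: "\<And>n. quad_of (pure (replicate k (coxeter_pow n)) x) = (\<Sum>m\<le>2 * k. b m * ?t m ^ n)"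
      using coxeter_tensor_expansion[OF True] by blast
    have neg: "quad_of (- c) = - quad_of c" for c by (simp add: quad.expand)
    have *: "quad_of (coxeter_quot k j n x) = (\<Sum>m\<le>2 * k. b m * (\<Prod>i<j. ?q i m) * ?t m ^ n)" for j n
    proof (induction j arbitrary: n)
      case 0 then show ?case by (simp add: b)
    next
      case (Suc j)
      have "quad_of (coxeter_quot k (Suc j) n x) = quad_of (coxeter_quot k j (Suc (Suc n)) x)
        + - quad_of (2 * cos2 j) * quad_of (coxeter_quot k j (Suc n) x) + quad_of (coxeter_quot k j n x)"
        by (simp only: coxeter_quot.simps tensor_apply quad_of_hom neg)
      also have "\<dots> = (\<Sum>m\<le>2 * k. b m * (\<Prod>i<j. ?q i m) * ?t m ^ Suc (Suc n)
        + - quad_of (2 * cos2 j) * (b m * (\<Prod>i<j. ?q i m) * ?t m ^ Suc n) + b m * (\<Prod>i<j. ?q i m) * ?t m ^ n)"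
        unfolding Suc by (simp only: sum.distrib sum_distrib_left)
      also have "\<dots> = (\<Sum>m\<le>2 * k. b m * (\<Prod>i<Suc j. ?q i m) * ?t m ^ n)"
      proof (rule sum.cong[OF refl])
        fix m
        have "b * p * t ^ Suc (Suc n) + - c * (b * p * t ^ Suc n) + b * p * t ^ n
          = b * (p * (t\<^sup>2 - c * t + 1)) * t ^ n" for b p t c :: quad
          by (simp add: power2_eq_square algebra_simps)
        then show "b m * (\<Prod>i<j. ?q i m) * ?t m ^ Suc (Suc n)
          + - quad_of (2 * cos2 j) * (b m * (\<Prod>i<j. ?q i m) * ?t m ^ Suc n) + b m * (\<Prod>i<j. ?q i m) * ?t m ^ n
          = b m * (\<Prod>i<Suc j. ?q i m) * ?t m ^ n"
          by (simp only: prod.lessThan_Suc)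
      qed
      finally show ?case .
    qed
    have "(\<Prod>i<Suc k. ?q i m) = 0" if "m \<le> 2 * k" for m
    proof -
      have "\<exists>i<Suc k. ?q i m = 0"
      proof (cases "k \<le> m")
        case True
        have "?t m = omega ^ (m - k)"
          using True omega_power_norm(2)[of k] power_add[of omega k "m - k"]
          by (simp flip: mult.assoc)
        then show ?thesis using omega_power_root[of "m - k"] that by (intro exI[of _ "m - k"]) simp
      next
        case False
        have "qconj omega ^ k = qconj omega ^ (k - m) * qconj omega ^ m"
          using False by (simp flip: power_add)
        then have "?t m = qconj omega ^ (k - m)"
          using omega_power_norm(2)[of m] by (simp add: mult.assoc)
        then show ?thesis using qconj_omega_power_root[of "k - m"] by (intro exI[of _ "k - m"]) simp
      qed
      then show ?thesis by (intro prod_zero) auto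
    qed
    then have "quad_of (coxeter_quot k (Suc k) n x) = quad_of 0"
      unfolding * by (simp add: quad_of_hom(1))
    then show ?thesis by (simp only: quad_of_inject zero_fun_apply)
  qed
qed

section \<open>Irreducible representations\<close>

lemma refl_tensor_invol:
  assumes "i \<in> {1, 2}"
  shows "tmult k (refl_tensor k i) (refl_tensor k i) = tone k"
proof -
  have "refl_H i = hmult (refl_H i) (T id)"
    using hmult_refl_H[OF assms, of "T id"] lmul_T[OF S3_mem(1) assms] assms
    by (auto simp: refl_H_def len_values)
  moreover have "hmult (refl_H i) (hmult (refl_H i) (T id)) = T id"
    using supp_S3_coxeter_pow[of 0] by (intro refl_H_invol assms) (simp add: coxeter_pow_simps)
  ultimately have "hmult (refl_H i) (refl_H i) = T id" by simp
  then show ?thesis by (simp add: refl_tensor_def pure_replicate_mult tone_def)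
qed

lemma coxeter_quot_in_K_check_H: "coxeter_quot k j n \<in> K_check_H k"
proof (induction j arbitrary: n)
  case 0
  show ?case
  proof (induction n)
    case 0 show ?case using K_check_H_closed(1)[of k] by (simp add: coxeter_pow_simps tone_def)
  next
    case (Suc n)
    have "coxeter_quot k 0 (Suc n) = tmult k (refl_tensor k 1) (tmult k (refl_tensor k 2) (coxeter_quot k 0 n))"
      by (simp add: coxeter_pow_simps refl_tensor_def pure_replicate_mult)
    then show ?case using Suc by (simp add: K_check_H_tmult refl_in_K_check_H)
  qed
qed (simp add: K_check_H_closed)

section \<open>Identification of an arbitrary irreducible module\<close>

locale check_irrep =
  fixes k :: nat and sc :: "K \<Rightarrow> 'v::ab_group_add \<Rightarrow> 'v" and \<rho> :: "tensor \<Rightarrow> 'v \<Rightarrow> 'v"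
  assumes irrep: "is_irrep k sc \<rho>"
begin

lemma rep: "is_rep k sc \<rho>"
  using irrep by (simp add: is_irrep_def)

sublocale vector_space sc
  by (rule is_repD(1)[OF rep])

abbreviation R :: "nat \<Rightarrow> 'v \<Rightarrow> 'v" where
  "R i \<equiv> \<rho> (refl_tensor k i)"

lemma R_linear:
  assumes "i \<in> {1, 2}"
  shows "R i (v + w) = R i v + R i w" "R i (sc c v) = sc c (R i v)" "R i 0 = 0" "R i (v - w) = R i v - R i w"
proof -
  show *: "R i (v + w) = R i v + R i w" "R i (sc c v) = sc c (R i v)" for v w c
    using assms by (simp_all add: is_repD[OF rep] refl_in_K_check_H)
  show "R i 0 = 0" using *(2)[of 0 0] by simp
  show "R i (v - w) = R i v - R i w" using *(1)[of "v - w" w] by (simp add: algebra_simps)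
qed

lemma R_invol: "i \<in> {1, 2} \<Longrightarrow> R i (R i v) = v"
  using is_repD(6)[OF rep refl_in_K_check_H refl_in_K_check_H] is_repD(4)[OF rep]
  by (metis refl_tensor_invol)

lemma P_R: "i \<in> {1, 2} \<Longrightarrow> \<rho> (P k i) v = sc (two ^ k / 2) (R i v + v)"
  by (simp add: P_eq_refl_tensor is_repD[OF rep] refl_in_K_check_H K_check_H_closed)

lemma invariant:
  assumes "subspace W" "\<And>i v. i \<in> {1, 2} \<Longrightarrow> v \<in> W \<Longrightarrow> R i v \<in> W" "w \<in> W" "w \<noteq> 0"
  shows "v \<in> W"
proof (rule irrep_invariant[OF irrep assms(1) _ assms(3,4)])
  fix i v assume "i \<in> {1, 2 :: nat}" "v \<in> W"
  then show "\<rho> (P k i) v \<in> W"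
    by (simp only: P_R) (intro subspace_scale subspace_add assms(1,2))
qed

lemma coxeter_quot_step:
  "\<rho> (coxeter_quot k (Suc j) n) v = \<rho> (coxeter_quot k j (Suc (Suc n))) v
    + sc (- (2 * cos2 j)) (\<rho> (coxeter_quot k j (Suc n)) v) + \<rho> (coxeter_quot k j n) v"
  by (simp only: coxeter_quot.simps is_repD[OF rep] K_check_H_closed coxeter_quot_in_K_check_H)

lemma coxeter_quot_Suc: "\<rho> (coxeter_quot k j (Suc n)) v = R 1 (R 2 (\<rho> (coxeter_quot k j n) v))"
proof (induction j arbitrary: n)
  case 0
  have "coxeter_quot k 0 (Suc n) = tmult k (refl_tensor k 1) (tmult k (refl_tensor k 2) (coxeter_quot k 0 n))"
    by (simp add: coxeter_pow_simps refl_tensor_def pure_replicate_mult)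
  then show ?case
    by (simp only: is_repD(6)[OF rep] refl_in_K_check_H K_check_H_tmult coxeter_quot_in_K_check_H insertI1 insertI2)
next
  case (Suc j)
  show ?case by (simp only: coxeter_quot_step Suc.IH R_linear insertI1 insertI2)
qed

text \<open>The factors of the vanishing product are applied in turn to a nonzero vector; the last
  nonzero result is an eigenvector of the central element, whose eigenspace is invariant.\<close>

lemma central_character: "\<exists>j\<le>k. \<forall>v. R 1 (R 2 v) + R 2 (R 1 v) = sc (2 * cos2 j) v"
proof -
  obtain v :: 'v where v: "v \<noteq> 0" using irrep by (auto simp: is_irrep_def)
  let ?w = "\<lambda>j. \<rho> (coxeter_quot k j 0) v"
  have w0: "?w 0 = v"
    using is_repD(4)[OF rep] by (simp add: coxeter_pow_simps flip: tone_def)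
  have "?w (Suc k) = 0"
    unfolding coxeter_quot_eq_0
    using is_repD(7)[OF rep K_check_H_closed(1), of 0 v] by simp
  moreover have "?w n \<noteq> 0" if "n \<le> Suc k" "\<And>j. j \<le> k \<Longrightarrow> ?w j \<noteq> 0 \<Longrightarrow> ?w (Suc j) \<noteq> 0" for n
    using that(1)
  proof (induction n)
    case 0 show ?case unfolding w0 by (rule v)
  next
    case (Suc n) then show ?case using that(2)[of n] by (simp del: coxeter_quot.simps)
  qed
  ultimately have "\<exists>j\<le>k. ?w j \<noteq> 0 \<and> ?w (Suc j) = 0" by blast
  then obtain j where j: "j \<le> k" "?w j \<noteq> 0" "?w (Suc j) = 0" by blast
  define w where "w = ?w j"
  have "R 1 (R 2 (R 1 (R 2 w))) + sc (- (2 * cos2 j)) (R 1 (R 2 w)) + w = 0"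
    using j(3) unfolding w_def by (simp only: coxeter_quot_step coxeter_quot_Suc)
  \<comment> \<open>Multiplication by R_2 R_1, the inverse of R_1 R_2, turns the quadratic equation
    into a trace condition.\<close>
  then have "R 2 (R 1 (R 1 (R 2 (R 1 (R 2 w))) + sc (- (2 * cos2 j)) (R 1 (R 2 w)) + w)) = 0"
    by (simp add: R_linear)
  then have w: "R 1 (R 2 w) + R 2 (R 1 w) = sc (2 * cos2 j) w"
    by (simp add: R_linear R_invol algebra_simps)
  have "v \<in> {v. R 1 (R 2 v) + R 2 (R 1 v) = sc (2 * cos2 j) v}" for v
  proof (rule invariant[where w = w])
    show "subspace {v. R 1 (R 2 v) + R 2 (R 1 v) = sc (2 * cos2 j) v}"
    proof (rule subspaceI)
      fix c v assume "v \<in> {v. R 1 (R 2 v) + R 2 (R 1 v) = sc (2 * cos2 j) v}"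
      then have "sc c (R 1 (R 2 v) + R 2 (R 1 v)) = sc c (sc (2 * cos2 j) v)" by simp
      then show "sc c v \<in> {v. R 1 (R 2 v) + R 2 (R 1 v) = sc (2 * cos2 j) v}"
        by (simp add: R_linear scale_right_distrib mult.commute)
    qed (simp_all add: R_linear algebra_simps)
    fix i v assume "i \<in> {1, 2 :: nat}" and v: "v \<in> {v. R 1 (R 2 v) + R 2 (R 1 v) = sc (2 * cos2 j) v}"
    then consider "i = 1" | "i = 2" by blast
    then show "R i v \<in> {v. R 1 (R 2 v) + R 2 (R 1 v) = sc (2 * cos2 j) v}"
    proof cases
      case 1
      have "R 1 (sc (2 * cos2 j) v) = R 1 (R 1 (R 2 v) + R 2 (R 1 v))" using v by simp
      then show ?thesis unfolding 1 by (simp add: R_linear R_invol algebra_simps)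
    next
      case 2
      have "R 2 (sc (2 * cos2 j) v) = R 2 (R 1 (R 2 v) + R 2 (R 1 v))" using v by simp
      then show ?thesis unfolding 2 by (simp add: R_linear R_invol algebra_simps)
    qed
  qed (use w j(2) in \<open>simp_all add: w_def\<close>)
  then show ?thesis using j(1) by blast
qed

lemma iso_one_dim:
  assumes "is_rep k (*) (\<sigma> :: tensor \<Rightarrow> K \<Rightarrow> K)" "\<And>i a. i \<in> {1, 2} \<Longrightarrow> \<sigma> (P k i) a = c * a"
    and "\<And>i. i \<in> {1, 2} \<Longrightarrow> \<rho> (P k i) v = sc c v" "v \<noteq> 0"
  shows "rep_iso k sc \<rho> (*) \<sigma>"
proof (rule schur[OF is_irrep_one_dim[OF assms(1)] irrep])
  show "Vector_Spaces.linear (*) sc (\<lambda>a. sc a v)"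
    by (simp add: Vector_Spaces.linear_iff vector_space_over_itself.vector_space_axioms vector_space_axioms
        scale_left_distrib)
  show "sc (\<sigma> (P k i) a) v = \<rho> (P k i) (sc a v)" if "i \<in> {1, 2}" for i a
    using that by (simp add: assms(2,3) is_repD(3)[OF rep] K_check_H_closed mult.commute)
  show "sc 1 v \<noteq> 0" using assms(4) by simp
qed

text \<open>Here (R_1 - R_2)^2 = 2 - (R_1 R_2 + R_2 R_1) = 0, so the invariant kernel of R_1 - R_2
  is everything. For nonzero v, either R_1 v + v is a nonzero vector fixed by both involutions or v
  is negated by both.\<close>

lemma iso_eps:
  assumes k: "k \<ge> 1" and z: "\<And>v. R 1 (R 2 v) + R 2 (R 1 v) = sc (2 * cos2 0) v"
  shows "rep_iso k sc \<rho> (*) (check_eps_plus k) \<or> rep_iso k sc \<rho> (*) (check_eps_minus k)"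
proof -
  have two_v: "sc 2 v = v + v" for v
    using scale_left_distrib[of 1 1 v] by simp
  have z': "R 1 (R 2 v) + R 2 (R 1 v) = v + v" for v
    using z[of v] by (simp add: two_v)
  obtain v :: 'v where v: "v \<noteq> 0" using irrep by (auto simp: is_irrep_def)
  have sub: "subspace {v. R 1 v = R 2 v}"
    by (rule subspaceI) (simp_all add: R_linear)
  have inv: "R i w \<in> {v. R 1 v = R 2 v}" if "i \<in> {1, 2}" "w \<in> {v. R 1 v = R 2 v}" for i w
  proof -
    have "R 1 w = R 2 w" using that by simp
    moreover have "R 1 (R 1 w) = w" "R 2 (R 2 w) = w" by (simp_all add: R_invol)
    ultimately show ?thesis using that(1) by auto
  qed
  have eq: "R 1 w = R 2 w" for w
  proof (rule ccontr)
    assume ne: "R 1 w \<noteq> R 2 w"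
    let ?d = "R 1 w - R 2 w"
    have "R 1 ?d - R 2 ?d = (w + w) - (R 1 (R 2 w) + R 2 (R 1 w))"
      by (simp add: R_linear R_invol algebra_simps)
    then have "?d \<in> {v. R 1 v = R 2 v}" by (simp add: z')
    from invariant[OF sub inv this, of w] ne show False by simp
  qed
  show ?thesis
  proof (cases "R 1 v + v = 0")
    case False
    let ?w = "R 1 v + v"
    have "\<rho> (P k i) ?w = sc (two ^ k) ?w" if "i \<in> {1, 2}" for i
    proof -
      have "R i ?w = ?w" using that eq[symmetric] by (auto simp: R_linear R_invol add.commute)
      then have "\<rho> (P k i) ?w = sc (two ^ k / 2) (sc 2 ?w)" using that by (simp add: P_R two_v)
      then show ?thesis by simp
    qed
    moreover have "check_eps_plus k (P k i) a = two ^ k * a" "is_rep k (*) (check_eps_plus k)" if "i \<in> {1, 2}" for i a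
      using check_eps_plus[of k] that by (auto simp: extends_to_rep_def)
    ultimately show ?thesis using iso_one_dim[of "check_eps_plus k" "two ^ k" ?w] False by blast
  next
    case True
    have "\<rho> (P k i) v = sc 0 v" if "i \<in> {1, 2}" for i
    proof -
      have "R i v + v = 0" using that True eq[symmetric, of v] by auto
      then show ?thesis using that by (simp add: P_R)
    qed
    moreover have "check_eps_minus k (P k i) a = 0 * a" "is_rep k (*) (check_eps_minus k)" if "i \<in> {1, 2}" for i a
      using check_eps_minus[OF k] that by (auto simp: extends_to_rep_def)
    ultimately show ?thesis using iso_one_dim[of "check_eps_minus k" 0 v] v by blast
  qed
qed

lemma iso_check_M:
  assumes j: "1 \<le> j" "j \<le> k" and z: "\<And>v. R 1 (R 2 v) + R 2 (R 1 v) = sc (2 * cos2 j) v"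
  shows "rep_iso k sc \<rho> (*s) (eps_tensor k j (check_M j))"
proof -
  let ?p = "two ^ k"
  let ?d = "two ^ (k - j)"
  let ?c = "?d * (two ^ j * a_cheb j)\<^sup>2"
  have two_v: "sc 2 v = v + v" for v
    using scale_left_distrib[of 1 1 v] by simp
  have pp: "?p = ?d * two ^ j" using j by (simp flip: power_add)
  \<comment> \<open>If R_1 = -1, the trace condition gives R_2 = -\<open>cos2 j\<close>, and R_2^2 =
    1 contradicts \<open>cos2_square_ne_1\<close>.\<close>
  have "\<exists>v. R 1 v + v \<noteq> 0"
  proof (rule ccontr)
    assume "\<nexists>v. R 1 v + v \<noteq> 0"
    then have R1: "R 1 v = - v" for v by (simp add: eq_neg_iff_add_eq_0)
    have neg: "R 2 (- v) = - R 2 v" for v using R_linear(4)[of 2 0 v] by (simp add: R_linear(3))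
    obtain v :: 'v where v: "v \<noteq> 0" using irrep by (auto simp: is_irrep_def)
    have "sc (- 2) (R 2 w) = sc (2 * cos2 j) w" for w
      using z[of w] by (simp add: R1 neg two_v scale_minus_left)
    then have "sc (- 1 / 2) (sc (- 2) (R 2 w)) = sc (- 1 / 2) (sc (2 * cos2 j) w)" for w by simp
    then have R2: "R 2 w = sc (- cos2 j) w" for w by simp
    have "v = sc ((cos2 j)\<^sup>2) v"
      using R_invol[of 2 v] by (simp add: R2 power2_eq_square)
    then have "sc ((cos2 j)\<^sup>2 - 1) v = 0" by (simp add: scale_left_diff_distrib)
    with v cos2_square_ne_1[OF j(1)] show False by simp
  qed
  then obtain v0 where v0: "R 1 v0 + v0 \<noteq> 0" by blast
  define v where "v = R 1 v0 + v0"
  have v: "v \<noteq> 0" "R 1 v = v"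
    using v0 by (simp_all add: v_def R_linear R_invol add.commute)
  have P1v: "\<rho> (P k 1) v = sc ?p v"
    by (simp add: P_R v(2)) (simp flip: two_v)
  have P2P2: "\<rho> (P k 2) (\<rho> (P k 2) w) = sc ?p (\<rho> (P k 2) w)" for w
  proof -
    have "R 2 (\<rho> (P k 2) w) = \<rho> (P k 2) w" by (simp add: P_R R_linear R_invol add.commute)
    then have "\<rho> (P k 2) (\<rho> (P k 2) w) = sc (?p / 2) (sc 2 (\<rho> (P k 2) w))"
      by (simp add: P_R[of 2 "\<rho> (P k 2) w"] two_v)
    then show ?thesis by simp
  qed
  \<comment> \<open>As R_1 v = v, the product (R_1 + 1) (R_2 + 1) v contains exactly the central
    element and 2 v.\<close>
  have P1P2: "\<rho> (P k 1) (\<rho> (P k 2) v) = sc (?p\<^sup>2 * (a_cheb j)\<^sup>2) v"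
  proof -
    have "\<rho> (P k 1) (\<rho> (P k 2) v) = sc (?p / 2) (sc (?p / 2) (R 1 (R 2 v) + R 2 (R 1 v) + (v + v)))"
      by (simp add: P_R R_linear v(2) scale_right_distrib add_ac)
    also have "\<dots> = sc (?p / 2) (sc (?p / 2) (sc (2 * cos2 j + 2) v))"
      unfolding z by (simp add: scale_left_distrib two_v)
    also have "\<dots> = sc (?p / 2 * (?p / 2) * (2 * cos2 j + 2)) v" by (simp add: mult.assoc)
    also have "?p / 2 * (?p / 2) * (2 * cos2 j + 2) = ?p\<^sup>2 * (a_cheb j)\<^sup>2"
      by (simp add: cos2_def power2_eq_square)
    finally show ?thesis .
  qed
  \<comment> \<open>In the contracted module P_2 sends the first basis vector to \<open>?d\<close>
    times the second, whence the division.\<close>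
  let ?\<psi> = "\<lambda>w :: K^2. sc (w $ 1) v + sc (w $ 2 / ?d) (\<rho> (P k 2) v)"
  show ?thesis
  proof (rule schur[OF is_irrep_check_M[OF j] irrep])
    show "Vector_Spaces.linear (*s) sc ?\<psi>"
      by (simp add: Vector_Spaces.linear_iff vec.vector_space_axioms vector_space_axioms
          scale_left_distrib scale_right_distrib add_divide_distrib)
    show "?\<psi> (vector [1, 0]) \<noteq> 0" using v by simp
    fix i and w :: "K^2" assume "i \<in> {1, 2 :: nat}"
    then consider "i = 1" | "i = 2" by blast
    then show "?\<psi> (eps_tensor k j (check_M j) (P k i) w) = \<rho> (P k i) (?\<psi> w)"
    proof cases
      case 1
      have "?c * w $ 2 = w $ 2 / ?d * (?p\<^sup>2 * (a_cheb j)\<^sup>2)"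
        unfolding pp by (simp add: power2_eq_square)
      then show ?thesis unfolding 1
        by (simp add: eps_tensor_check_M[OF j] is_repD[OF rep] K_check_H_closed P1v P1P2 mult.commute
            flip: scale_left_distrib)
    next
      case 2
      have "(?d * w $ 1 + ?p * w $ 2) / ?d = w $ 1 + w $ 2 / ?d * ?p" by (simp add: field_simps)
      then show ?thesis unfolding 2
        by (simp add: eps_tensor_check_M[OF j] is_repD[OF rep] K_check_H_closed P2P2
            flip: scale_left_distrib)
    qed
  qed
qed

end

theorem theorem3p4:
  fixes k :: nat
  assumes "k \<ge> 1"
  shows
    "(\<forall>j\<in>{1..k}. \<exists>\<rho>. is_check_X j ((two ^ j * a_cheb j)\<^sup>2) \<rho>) \<and>
     (\<exists>\<rho>. is_check_eps_plus k \<rho>) \<and> (\<exists>\<rho>. is_check_eps_minus k \<rho>) \<and>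
     is_irrep k (*) (check_eps_plus k) \<and>
     is_irrep k (*) (check_eps_minus k) \<and>
     (\<forall>j\<in>{1..k}. is_irrep k (*s) (eps_tensor k j (check_M j))) \<and>
     \<not> rep_iso k (*) (check_eps_plus k) (*) (check_eps_minus k) \<and>
     (\<forall>j\<in>{1..k}. \<not> rep_iso k (*) (check_eps_plus k) (*s) (eps_tensor k j (check_M j)) \<and>
                  \<not> rep_iso k (*) (check_eps_minus k) (*s) (eps_tensor k j (check_M j))) \<and>
     (\<forall>i\<in>{1..k}. \<forall>j\<in>{1..k}. i \<noteq> j \<longrightarrow>
        \<not> rep_iso k (*s) (eps_tensor k i (check_M i)) (*s) (eps_tensor k j (check_M j))) \<and>
     (\<forall>(sc :: K \<Rightarrow> 'v::ab_group_add \<Rightarrow> 'v) \<rho>. is_irrep k sc \<rho> \<longrightarrow>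
        rep_iso k sc \<rho> (*) (check_eps_plus k) \<or>
        rep_iso k sc \<rho> (*) (check_eps_minus k) \<or>
        (\<exists>j\<in>{1..k}. rep_iso k sc \<rho> (*s) (eps_tensor k j (check_M j))))"
proof (intro conjI ballI allI impI)
  show "\<exists>\<rho>. is_check_X j ((two ^ j * a_cheb j)\<^sup>2) \<rho>" if "j \<in> {1..k}" for j
    using that by (intro is_check_X_exists) simp
  show "\<exists>\<rho>. is_check_eps_plus k \<rho>" by (rule is_check_eps_plus_exists)
  show "\<exists>\<rho>. is_check_eps_minus k \<rho>" by (rule is_check_eps_minus_exists[OF assms])
  note plus = check_eps_plus[of k, unfolded extends_to_rep_def]
  note minus = check_eps_minus[OF assms, unfolded extends_to_rep_def]
  show "is_irrep k (*) (check_eps_plus k)" "is_irrep k (*) (check_eps_minus k)"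
    using plus minus by (blast intro: is_irrep_one_dim)+
  show "is_irrep k (*s) (eps_tensor k j (check_M j))" if "j \<in> {1..k}" for j
    using that by (intro is_irrep_check_M) simp_all
  show "\<not> rep_iso k (*) (check_eps_plus k) (*) (check_eps_minus k)" by (rule eps_not_iso[OF assms])
  show "\<not> rep_iso k (*) (check_eps_plus k) (*s) (eps_tensor k j (check_M j))" if "j \<in> {1..k}" for j
    using that plus scalar_not_iso[of j k "check_eps_plus k" "two ^ k"] by auto
  show "\<not> rep_iso k (*) (check_eps_minus k) (*s) (eps_tensor k j (check_M j))" if "j \<in> {1..k}" for j
    using that minus scalar_not_iso[of j k "check_eps_minus k" 0] by auto
  show "\<not> rep_iso k (*s) (eps_tensor k i (check_M i)) (*s) (eps_tensor k j (check_M j))"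
    if "i \<in> {1..k}" "j \<in> {1..k}" "i \<noteq> j" for i j
    using that check_M_not_iso[of i k j] by auto
  fix sc :: "K \<Rightarrow> 'v \<Rightarrow> 'v" and \<rho>
  assume "is_irrep k sc \<rho>"
  then interpret check_irrep k sc \<rho> by unfold_locales
  obtain j where j: "j \<le> k" "\<And>v. R 1 (R 2 v) + R 2 (R 1 v) = sc (2 * cos2 j) v"
    using central_character by blast
  show "rep_iso k sc \<rho> (*) (check_eps_plus k) \<or> rep_iso k sc \<rho> (*) (check_eps_minus k) \<or>
      (\<exists>j\<in>{1..k}. rep_iso k sc \<rho> (*s) (eps_tensor k j (check_M j)))"
  proof (cases "j = 0")
    case True
    then show ?thesis using iso_eps[OF assms] j(2) by blast
  next
    case False
    then have "j \<in> {1..k}" "1 \<le> j" using j(1) by auto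
    then show ?thesis using iso_check_M[OF _ j] by blast
  qed
qed

end
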